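(* Let $n,m\geq 2$, $i\in\{1,\dots,2n\}$, $j\in\{1,\dots,2m\}$ with $j$ odd, and $k,l\geq 1$. (1) $(\alpha^*_{m,l,j},\beta^*_{m,l,j})$ is a consequence of $(\alpha^*_{n,k,i},\beta^*_{n,k,i})$ if and only if either $n\geq m$ and $l>k$; or $n\geq m$, $l=k$ and $j\geq i+2m-2n$. (2) $(\alpha^*_{m,l,j},\beta^*_{m,l,j})$ is a consequence of $(\alpha_{n,k,i},\beta_{n,k,i})$ if and only if either $n\geq m$ and $l>k$; or $n\geq m$, $l=k$ and $j>i+2m-2n$. (3) $(\alpha_{n,k,i},\beta_{n,k,i})$ is a consequence of $(\alpha^*_{m,l,j},\beta^*_{m,l,j})$ if and only if either $m\geq n$ and $k>l$; or $m\geq n$, $k=l$ and $i>j+2n-2m$.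
   Context: $X$ is a countably infinite set of letters containing distinct letters $x_1,x_2,\dots$. Bi-rooted trees. $\mathfrak B'(X)$ is the set of finite trees (up to isomorphism) with at least two vertices, all vertices labelled by letters of $X$, with an ordered pair of adjacent distinguished vertices (left root, right root). For $\alpha,\beta\in\mathfrak B'(X)$, $\alpha\sqcap\beta$ is the disjoint union of $\alpha$ and $\beta$ with an added edge joining the left root of $\alpha$ to the right root of $\beta$; these two vertices are the left and the right root of $\alpha\sqcap\beta$. A thorn is a degree-one vertex $a$ together with its edge $e$, such that both endpoints of $e$ have the same label; it is essential if $a$ is a root, non-essential otherwise. Reductions: (i) delete a non-essential thorn; (ii) edge-folding: if two distinct vertices with the same label have a common neighbour, merge them (and the two edges to the common neighbour), keeping the label, the merged vertex being a root if one of the merged vertices was. A tree is reduced if no reduction applies; each $\gamma\in\mathfrak B'(X)$ has a unique reduced form $\overline\gamma$. $\mathfrak A(X)$ is the set of reduced trees in $\mathfrak B'(X)$, with operation $\alpha\wedge\beta=\overline{\alpha\sqcap\beta}$; it is the free pseudosemilattice on $X$, with $x\in X$ identified with the single edge both of whose endpoints are labelled $x$. (A pseudosemilattice is a binary algebra satisfying $x\wedge x\approx x$; $(x\wedge y)\wedge(x\wedge z)\approx(x\wedge y)\wedge z$; $((x\wedge y)\wedge(x\wedge z))\wedge(x\wedge w)\approx(x\wedge y)\wedge((x\wedge z)\wedge(x\wedge w))$; and the left-right duals of the last two.) A pair $\sigma\in\mathfrak A(X)\times\mathfrak A(X)$ is a consequence of a pair $\tau$ (or of a set $\tau$ of pairs)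 if it belongs to the fully invariant congruence on $\mathfrak A(X)$ generated by $\tau$ (equivalently, the identity given by $\sigma$ holds in the variety of pseudosemilattices defined by the identities given by $\tau$). The trees. For $n\ge2$, $k\ge1$, $1\le i\le 2n$: $\alpha_{n,k,i}$ is the path $a_1,a_2,\dots,a_{2nk+i}$ (consecutive vertices adjacent), $a_p$ labelled $x_q$ with $1\le q\le 2n$ and $q\equiv p\pmod{2n}$, with left root $a_1$ and right root $a_2$. $\beta_{n,k,i}$ is obtained from $\alpha_{n,k,i}$ by adding one new vertex labelled $x_{2n}$, adjacent only to $a_1$. $\alpha^*_{n,k,i}$ and $\beta^*_{n,k,i}$ are the same labelled trees as $\alpha_{n,k,i}$ and $\beta_{n,k,i}$ respectively, but with left root $a_2$ and right root $a_1$. All these trees are in $\mathfrak A(X)$. *)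

theory Defs
  imports "HOL-Library.Countable"
begin

section \<open>Bi-rooted labelled trees\<close>

text \<open>
  Trees are represented by concrete graphs whose vertices are natural numbers; only the restriction
  of the labelling to the vertex set matters, and all notions are used up to isomorphism.
\<close>

record 'a bitree =
  verts :: "nat set"
  adj :: "(nat \<times> nat) set"
  lab :: "nat \<Rightarrow> 'a"
  lroot :: nat
  rroot :: nat

definition has_cycle :: "(nat \<times> nat) set \<Rightarrow> bool" where
  "has_cycle E \<longleftrightarrow> (\<exists>c. length c \<ge> 3 \<and> distinct c \<and>
     (\<forall>i < length c. (c ! i, c ! (Suc i mod length c)) \<in> E))"

definition is_tree :: "nat set \<Rightarrow> (nat \<times> nat) set \<Rightarrow> bool" where
  "is_tree V E \<longleftrightarrow> E \<subseteq> V \<times> V \<and> sym E \<and> irrefl E \<and> V \<noteq> {} \<and>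
     (\<forall>u\<in>V. \<forall>v\<in>V. (u, v) \<in> E\<^sup>*) \<and> \<not> has_cycle E"

text \<open>Adjacency of the roots forces at least two vertices.\<close>

definition bitree :: "'a bitree \<Rightarrow> bool" where
  "bitree T \<longleftrightarrow> finite (verts T) \<and> is_tree (verts T) (adj T) \<and> (lroot T, rroot T) \<in> adj T"

definition tree_iso :: "'a bitree \<Rightarrow> 'a bitree \<Rightarrow> bool" where
  "tree_iso S T \<longleftrightarrow> (\<exists>f. bij_betw f (verts S) (verts T) \<and>
     (\<forall>u\<in>verts S. \<forall>v\<in>verts S. (u, v) \<in> adj S \<longleftrightarrow> (f u, f v) \<in> adj T) \<and>
     (\<forall>u\<in>verts S. lab S u = lab T (f u)) \<and>
     f (lroot S) = lroot T \<and> f (rroot S) = rroot T)"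

text \<open>The operation \<open>\<sqinter>\<close>; the disjoint union puts the vertices of \<open>S\<close> on the
  even numbers and those of \<open>T\<close> on the odd numbers.\<close>

definition join :: "'a bitree \<Rightarrow> 'a bitree \<Rightarrow> 'a bitree" where
  "join S T =
    (let f = (\<lambda>v. 2 * v); g = (\<lambda>v. 2 * v + 1); a = f (lroot S); b = g (rroot T) in
     \<lparr> verts = f ` verts S \<union> g ` verts T,
       adj = map_prod f f ` adj S \<union> map_prod g g ` adj T \<union> {(a, b), (b, a)},
       lab = (\<lambda>v. if even v then lab S (v div 2) else lab T (v div 2)),
       lroot = a,
       rroot = b \<rparr>)"

section \<open>Reduction\<close>

definition thorn :: "'a bitree \<Rightarrow> nat \<Rightarrow> bool" where
  "thorn T a \<longleftrightarrow> a \<in> verts T \<and> (\<exists>b. {v. (a, v) \<in> adj T} = {b} \<and> lab T a = lab T b)"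

definition essential :: "'a bitree \<Rightarrow> nat \<Rightarrow> bool" where
  "essential T a \<longleftrightarrow> a = lroot T \<or> a = rroot T"

definition delete_vertex :: "'a bitree \<Rightarrow> nat \<Rightarrow> 'a bitree" where
  "delete_vertex T a =
     T\<lparr> verts := verts T - {a}, adj := {(u, v) \<in> adj T. u \<noteq> a \<and> v \<noteq> a} \<rparr>"

definition merge :: "'a bitree \<Rightarrow> nat \<Rightarrow> nat \<Rightarrow> 'a bitree" where
  "merge T u v =
    (let f = (\<lambda>w. if w = v then u else w) in
     T\<lparr> verts := f ` verts T, adj := map_prod f f ` adj T,
        lroot := f (lroot T), rroot := f (rroot T) \<rparr>)"

inductive reduction :: "'a bitree \<Rightarrow> 'a bitree \<Rightarrow> bool" where
  thorn_deletion: "thorn T a \<Longrightarrow> \<not> essential T a \<Longrightarrow> reduction T (delete_vertex T a)"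
| edge_folding: "u \<noteq> v \<Longrightarrow> lab T u = lab T v \<Longrightarrow> (u, w) \<in> adj T \<Longrightarrow> (v, w) \<in> adj T
    \<Longrightarrow> reduction T (merge T u v)"

definition reduced :: "'a bitree \<Rightarrow> bool" where
  "reduced T \<longleftrightarrow> \<not> (\<exists>T'. reduction T T')"

section \<open>The free pseudosemilattice\<close>

definition reduced_iso :: "'a bitree \<Rightarrow> 'a bitree \<Rightarrow> bool" where
  "reduced_iso S T \<longleftrightarrow> bitree S \<and> reduced S \<and> bitree T \<and> reduced T \<and> tree_iso S T"

lemma tree_iso_refl: "tree_iso T T"
  unfolding tree_iso_def by (rule exI[of _ id]) auto

lemma tree_iso_sym:
  assumes "tree_iso S T" "bitree S"
  shows "tree_iso T S"
proof -
  from assms(1) obtain f where f: "bij_betw f (verts S) (verts T)"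
    "\<And>u v. u \<in> verts S \<Longrightarrow> v \<in> verts S \<Longrightarrow> (u, v) \<in> adj S \<longleftrightarrow> (f u, f v) \<in> adj T"
    "\<And>u. u \<in> verts S \<Longrightarrow> lab S u = lab T (f u)"
    "f (lroot S) = lroot T" "f (rroot S) = rroot T"
    unfolding tree_iso_def by blast
  let ?g = "inv_into (verts S) f"
  have roots: "lroot S \<in> verts S" "rroot S \<in> verts S"
    using assms(2) by (auto simp: bitree_def is_tree_def)
  have g: "?g u \<in> verts S" "f (?g u) = u" if "u \<in> verts T" for u
    using that f(1) by (auto simp: bij_betw_def inv_into_into f_inv_into_f)
  have inv: "?g (f u) = u" if "u \<in> verts S" for u
    using that f(1) by (auto simp: bij_betw_def)
  have "?g (lroot T) = lroot S" "?g (rroot T) = rroot S"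
    using inv roots f(4,5) by metis+
  then show ?thesis
    unfolding tree_iso_def using bij_betw_inv_into[OF f(1)] f(2,3) g
    by (intro exI[of _ ?g]) auto
qed

lemma tree_iso_trans:
  assumes "tree_iso S T" "tree_iso T U"
  shows "tree_iso S U"
proof -
  from assms(1) obtain f where f: "bij_betw f (verts S) (verts T)"
    "\<And>u v. u \<in> verts S \<Longrightarrow> v \<in> verts S \<Longrightarrow> (u, v) \<in> adj S \<longleftrightarrow> (f u, f v) \<in> adj T"
    "\<And>u. u \<in> verts S \<Longrightarrow> lab S u = lab T (f u)"
    "f (lroot S) = lroot T" "f (rroot S) = rroot T"
    unfolding tree_iso_def by blast
  from assms(2) obtain g where g: "bij_betw g (verts T) (verts U)"
    "\<And>u v. u \<in> verts T \<Longrightarrow> v \<in> verts T \<Longrightarrow> (u, v) \<in> adj T \<longleftrightarrow> (g u, g v) \<in> adj U"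
    "\<And>u. u \<in> verts T \<Longrightarrow> lab T u = lab U (g u)"
    "g (lroot T) = lroot U" "g (rroot T) = rroot U"
    unfolding tree_iso_def by blast
  have "f u \<in> verts T" if "u \<in> verts S" for u
    using that f(1) by (auto simp: bij_betw_def)
  then show ?thesis
    unfolding tree_iso_def using bij_betw_trans[OF f(1) g(1)] f(2-) g(2-)
    by (intro exI[of _ "g \<circ> f"]) auto
qed

lemma path_no_cycle:
  assumes "E \<subseteq> {(p, q). q = Suc p \<or> p = Suc q}"
  shows "\<not> has_cycle E"
proof
  assume "has_cycle E"
  then obtain c where c: "length c \<ge> 3" "distinct c"
    "\<And>i. i < length c \<Longrightarrow> (c ! i, c ! (Suc i mod length c)) \<in> E"
    unfolding has_cycle_def by blast
  let ?n = "length c"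
  have "Max (set c) \<in> set c" using c(1) by (intro Max_in) auto
  then obtain i where i: "i < ?n" "c ! i = Max (set c)" by (auto simp: in_set_conv_nth)
  define s where "s = Suc i mod ?n"
  define r where "r = (if i = 0 then ?n - 1 else i - 1)"
  have "?n > 0" using c(1) by linarith
  then have lt: "s < ?n" "r < ?n" using i(1) by (auto simp: s_def r_def)
  have "Suc r mod ?n = i" using i(1) c(1) by (auto simp: r_def)
  then have "(c ! r, c ! i) \<in> E" "(c ! i, c ! s) \<in> E" using c(3)[of r] c(3)[of i] i lt
    by (auto simp: s_def)
  then have "c ! i = Suc (c ! r) \<or> c ! r = Suc (c ! i)" "c ! s = Suc (c ! i) \<or> c ! i = Suc (c ! s)"
    using assms by blast+
  moreover have "c ! r \<le> c ! i" "c ! s \<le> c ! i" using lt i(2) by auto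
  ultimately have "c ! r = c ! s" by linarith
  then have "r = s" using lt c(2) nth_eq_iff_index_eq by blast
  then show False using i(1) c(1)
    by (cases "Suc i = ?n") (auto simp: r_def s_def split: if_splits)
qed

lemma path_is_tree:
  assumes "a \<le> b"
  shows "is_tree {a..b} {(p, q) \<in> {a..b} \<times> {a..b}. q = Suc p \<or> p = Suc q}"
    (is "is_tree _ ?E")
proof -
  have "sym ?E" by (auto simp: sym_def)
  have up: "(a, a + d) \<in> ?E\<^sup>*" if "a + d \<le> b" for d
    using that
  proof (induction d)
    case (Suc d)
    then have "(a + d, a + Suc d) \<in> ?E" by auto
    moreover have "(a, a + d) \<in> ?E\<^sup>*" using Suc by simp
    ultimately show ?case by (rule rtrancl_into_rtrancl[rotated])
  qed simp
  have up': "(a, u) \<in> ?E\<^sup>*" if "u \<in> {a..b}" for u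
    using up[of "u - a"] that by auto
  have "(u, v) \<in> ?E\<^sup>*" if "u \<in> {a..b}" "v \<in> {a..b}" for u v
    using symD[OF sym_rtrancl[OF \<open>sym ?E\<close>] up'[OF that(1)]] up'[OF that(2)]
    by (rule rtrancl_trans)
  moreover have "\<not> has_cycle ?E" by (rule path_no_cycle) auto
  ultimately show ?thesis
    unfolding is_tree_def
    by (intro conjI ballI) (use assms \<open>sym ?E\<close> in \<open>simp_all add: irrefl_def subset_iff\<close>)
qed

text \<open>The single edge with both endpoints labelled by the same letter.\<close>

definition letter :: "'a \<Rightarrow> 'a bitree" where
  "letter y = \<lparr> verts = {0, 1}, adj = {(0, 1), (1, 0)}, lab = (\<lambda>_. y), lroot = 0, rroot = 1 \<rparr>"

lemma letter_reduced: "bitree (letter y)" "reduced (letter y)"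
proof -
  have V: "{0..1} = {0, 1::nat}" by auto
  have E: "{(p, q) \<in> {0..1} \<times> {0..1}. q = Suc p \<or> p = Suc q} = {(0, 1), (1, 0::nat)}"
    by auto
  have "is_tree {0, 1} {(0, 1), (1, 0)}"
    using path_is_tree[of 0 1] unfolding E unfolding V by simp
  then show "bitree (letter y)" by (simp add: bitree_def letter_def)
  show "reduced (letter y)"
    unfolding reduced_def
  proof
    assume "\<exists>T'. reduction (letter y) T'"
    then obtain T' where "reduction (letter y) T'" ..
    then show False
      by cases (auto simp: letter_def thorn_def essential_def)
  qed
qed

quotient_type 'a free_psl = "'a bitree" / partial: reduced_iso
proof (rule part_equivpI)
  show "\<exists>T :: 'a bitree. reduced_iso T T"
    unfolding reduced_iso_def
    by (intro exI[of _ "letter undefined"] conjI letter_reduced tree_iso_refl)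
  show "symp (reduced_iso :: 'a bitree \<Rightarrow> _)"
    by (intro sympI) (simp add: reduced_iso_def tree_iso_sym)
  show "transp (reduced_iso :: 'a bitree \<Rightarrow> _)"
    by (intro transpI) (unfold reduced_iso_def, elim conjE, intro conjI, assumption+,
        rule tree_iso_trans)
qed

text \<open>The reduced form of a bi-rooted tree, as an isomorphism class.\<close>

definition reduced_form :: "'a bitree \<Rightarrow> 'a free_psl" where
  "reduced_form T = (THE c. \<exists>U. reduction\<^sup>*\<^sup>* T U \<and> reduced U \<and> c = abs_free_psl U)"

definition meet :: "'a free_psl \<Rightarrow> 'a free_psl \<Rightarrow> 'a free_psl" where
  "meet a b = reduced_form (join (rep_free_psl a) (rep_free_psl b))"

section \<open>Consequences\<close>

definition endomorphism :: "('a free_psl \<Rightarrow> 'a free_psl) \<Rightarrow> bool" where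
  "endomorphism \<phi> \<longleftrightarrow> (\<forall>a b. \<phi> (meet a b) = meet (\<phi> a) (\<phi> b))"

definition congruence :: "('a free_psl \<times> 'a free_psl) set \<Rightarrow> bool" where
  "congruence \<theta> \<longleftrightarrow> equiv UNIV \<theta> \<and>
     (\<forall>a b c d. (a, b) \<in> \<theta> \<longrightarrow> (c, d) \<in> \<theta> \<longrightarrow> (meet a c, meet b d) \<in> \<theta>)"

definition fully_invariant :: "('a free_psl \<times> 'a free_psl) set \<Rightarrow> bool" where
  "fully_invariant \<theta> \<longleftrightarrow> (\<forall>\<phi> a b. endomorphism \<phi> \<longrightarrow> (a, b) \<in> \<theta> \<longrightarrow> (\<phi> a, \<phi> b) \<in> \<theta>)"

definition fully_invariant_congruence_generated ::
    "('a free_psl \<times> 'a free_psl) set \<Rightarrow> ('a free_psl \<times> 'a free_psl) set" where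
  "fully_invariant_congruence_generated R =
     \<Inter> {\<theta>. congruence \<theta> \<and> fully_invariant \<theta> \<and> R \<subseteq> \<theta>}"

definition is_consequence_of ::
    "'a free_psl \<times> 'a free_psl \<Rightarrow> 'a free_psl \<times> 'a free_psl \<Rightarrow> bool"
    (infix \<open>is'_consequence'_of\<close> 50) where
  "\<sigma> is_consequence_of \<tau> \<longleftrightarrow> \<sigma> \<in> fully_invariant_congruence_generated {\<tau>}"

section \<open>The trees \<open>\<alpha>\<close> and \<open>\<beta>\<close>\<close>

text \<open>The vertex \<open>a\<^sub>p\<close> of the path is the number \<open>p\<close>; the additional vertex of
  \<open>\<beta>\<close> is \<open>0\<close>.\<close>

definition alpha_tree :: "(nat \<Rightarrow> 'a) \<Rightarrow> nat \<Rightarrow> nat \<Rightarrow> nat \<Rightarrow> 'a bitree" where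
  "alpha_tree x n k i =
    (let V = {1..2 * n * k + i} in
     \<lparr> verts = V,
       adj = {(p, q) \<in> V \<times> V. q = Suc p \<or> p = Suc q},
       lab = (\<lambda>p. x (if 2 * n dvd p then 2 * n else p mod (2 * n))),
       lroot = 1,
       rroot = 2 \<rparr>)"

definition beta_tree :: "(nat \<Rightarrow> 'a) \<Rightarrow> nat \<Rightarrow> nat \<Rightarrow> nat \<Rightarrow> 'a bitree" where
  "beta_tree x n k i =
    (let T = alpha_tree x n k i in
     T\<lparr> verts := insert 0 (verts T),
        adj := adj T \<union> {(0, 1), (1, 0)},
        lab := (lab T)(0 := x (2 * n)) \<rparr>)"

definition swap_roots :: "'a bitree \<Rightarrow> 'a bitree" where
  "swap_roots T = T\<lparr> lroot := rroot T, rroot := lroot T \<rparr>"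

definition alpha :: "(nat \<Rightarrow> 'a) \<Rightarrow> nat \<Rightarrow> nat \<Rightarrow> nat \<Rightarrow> 'a free_psl" where
  "alpha x n k i = abs_free_psl (alpha_tree x n k i)"

definition beta :: "(nat \<Rightarrow> 'a) \<Rightarrow> nat \<Rightarrow> nat \<Rightarrow> nat \<Rightarrow> 'a free_psl" where
  "beta x n k i = abs_free_psl (beta_tree x n k i)"

definition alpha_star :: "(nat \<Rightarrow> 'a) \<Rightarrow> nat \<Rightarrow> nat \<Rightarrow> nat \<Rightarrow> 'a free_psl" where
  "alpha_star x n k i = abs_free_psl (swap_roots (alpha_tree x n k i))"

definition beta_star :: "(nat \<Rightarrow> 'a) \<Rightarrow> nat \<Rightarrow> nat \<Rightarrow> nat \<Rightarrow> 'a free_psl" where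
  "beta_star x n k i = abs_free_psl (swap_roots (beta_tree x n k i))"

text \<open>
  \<open>abs_free_psl\<close> is only meaningful on reduced bi-rooted trees; the following facts show that
  the trees above qualify.
\<close>

lemma beta_tree_eq:
  assumes "n \<ge> 2" "k \<ge> 1"
  shows "beta_tree x n k i =
    (let V = {0..2 * n * k + i} in
     \<lparr> verts = V,
       adj = {(p, q) \<in> V \<times> V. q = Suc p \<or> p = Suc q},
       lab = (\<lambda>p. x (if 2 * n dvd p then 2 * n else p mod (2 * n))),
       lroot = 1,
       rroot = 2 \<rparr>)"
proof -
  have "2 * n * 1 \<le> 2 * n * k" using assms(2) by (intro mult_le_mono) auto
  then have N: "2 \<le> 2 * n * k + i" using assms(1) by linarith
  then show ?thesis
    unfolding beta_tree_def alpha_tree_def Let_def by (auto simp: fun_eq_iff)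
qed

lemma alpha_beta_bitree:
  assumes "n \<ge> 2" "k \<ge> 1"
  shows "bitree (alpha_tree x n k i)" "bitree (beta_tree x n k i)"
proof -
  let ?N = "2 * n * k + i"
  have "2 * n * 1 \<le> 2 * n * k" using assms(2) by (intro mult_le_mono) auto
  then have N: "2 \<le> ?N" using assms(1) by linarith
  show "bitree (alpha_tree x n k i)"
    using path_is_tree[of 1 ?N] N by (simp add: bitree_def alpha_tree_def Let_def)
  show "bitree (beta_tree x n k i)"
    using path_is_tree[of 0 ?N] N by (simp add: bitree_def beta_tree_eq[OF assms] Let_def)
qed

lemma path_reduced:
  assumes "adj T \<subseteq> {(p, q). q = Suc p \<or> p = Suc q}"
    and "\<And>p. lab T p \<noteq> lab T (Suc p)" "\<And>p. lab T p \<noteq> lab T (Suc (Suc p))"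
  shows "reduced T"
proof -
  have "False" if "thorn T a" for a
  proof -
    from that obtain b where "(a, b) \<in> adj T" "lab T a = lab T b"
      by (auto simp: thorn_def)
    then show False using assms(1) assms(2)[of a] assms(2)[of b] by auto
  qed
  moreover have "False"
    if "u \<noteq> v" "lab T u = lab T v" "(u, w) \<in> adj T" "(v, w) \<in> adj T" for u v w
  proof -
    have "v = Suc (Suc u) \<or> u = Suc (Suc v)" using that assms(1) by auto
    then show False using that(2) assms(3)[of u] assms(3)[of v] by auto
  qed
  ultimately show ?thesis unfolding reduced_def by (auto simp: reduction.simps)
qed

lemma alpha_beta_reduced:
  assumes "inj_on x {1..}" "n \<ge> 2" "k \<ge> 1"
  shows "reduced (alpha_tree x n k i)" "reduced (beta_tree x n k i)"
proof -
  define r where "r = (\<lambda>p. if 2 * n dvd p then 2 * n else p mod (2 * n))"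
  have r_mod: "r p mod (2 * n) = p mod (2 * n)" for p
    by (auto simp: r_def)
  have r_pos: "r p \<in> {1..}" for p
    using assms(2) by (auto simp: r_def Suc_le_eq mod_greater_zero_iff_not_dvd)
  have "x (r p) \<noteq> x (r (p + d))" if "0 < d" "d < 2 * n" for p d
  proof
    assume "x (r p) = x (r (p + d))"
    then have "r p = r (p + d)" using assms(1) r_pos by (auto dest: inj_onD)
    then have "(p + d) mod (2 * n) = p mod (2 * n)" using r_mod by metis
    then have "2 * n dvd (p + d) - p" using mod_eq_dvd_iff_nat[of p "p + d" "2 * n"] by simp
    then show False using that by (auto dest: dvd_imp_le)
  qed
  from this[of 1] this[of 2]
  have *: "x (r p) \<noteq> x (r (Suc p))" "x (r p) \<noteq> x (r (Suc (Suc p)))" for p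
    using assms(2) by auto
  show "reduced (alpha_tree x n k i)"
    by (rule path_reduced) (use * in \<open>auto simp: alpha_tree_def Let_def r_def\<close>)
  show "reduced (beta_tree x n k i)"
    by (rule path_reduced) (use * in \<open>auto simp: beta_tree_eq[OF assms(2,3)] Let_def r_def\<close>)
qed

lemma swap_roots_bitree: "bitree T \<Longrightarrow> bitree (swap_roots T)"
  unfolding bitree_def swap_roots_def is_tree_def by simp (meson symD)

lemma swap_roots_reduced: "reduced T \<Longrightarrow> reduced (swap_roots T)"
  unfolding reduced_def
proof (erule contrapos_nn)
  assume "\<exists>T'. reduction (swap_roots T) T'"
  then obtain T' where "reduction (swap_roots T) T'" ..
  then show "\<exists>T'. reduction T T'"
  proof cases
    case (thorn_deletion a)
    then have "thorn T a" "\<not> essential T a"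
      by (auto simp: thorn_def essential_def swap_roots_def)
    then show ?thesis by (blast intro: reduction.thorn_deletion)
  next
    case (edge_folding u v w)
    then show ?thesis
      by (auto simp: swap_roots_def intro: reduction.edge_folding)
  qed
qed

end

theory Submission imports Defs begin

text \<open>
  A bi-rooted tree is interpreted in any bipartite labelled graph \<open>B\<close> in which the neighbour with a
  given label is unique and every vertex has a neighbour with its own label: its denotation is the set
  of images of the pair of roots under the label-preserving homomorphisms into \<open>B\<close>. Both reductions
  preserve denotations, and a reduced tree with thorns attached is itself such a graph, so two elements
  of the free pseudosemilattice are equal iff they have the same denotations. A substitution amounts to
  a change of the labels of \<open>B\<close>, and \<open>\<alpha>\<close> denotes walks labelled periodically by
  \<open>x\<^sub>1, \<dots>, x\<^sub>2\<^sub>n\<close>, while \<open>\<beta>\<close> requires one more vertex in front of the walk.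

  If the numerical condition holds, the walk of the target tree can be slowed down on thorns so that it
  becomes periodic of period \<open>2n\<close>, and one application of the given identity adds the missing vertex.
  If it fails, every \<open>2n\<close>-periodic walk of the given length in the target path has displacement
  \<open>0\<close> after \<open>2n\<close> steps. If a walk in a tree is closed, then so is every equally labelled walk in a graph
  \<open>B\<close>, hence the vertex added by \<open>\<beta>\<close> is already present, and the identity cannot change the target tree.
\<close>

section \<open>Trees\<close>

text \<open>A connected graph is acyclic iff it has a ranking, namely the distance from a vertex.\<close>

definition ranking :: "(nat \<times> nat) set \<Rightarrow> (nat \<Rightarrow> nat) \<Rightarrow> bool" where
  "ranking E rk \<longleftrightarrow>
     (\<forall>u v. (u, v) \<in> E \<longrightarrow> rk v = Suc (rk u) \<or> rk u = Suc (rk v)) \<and>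
     (\<forall>u v w. (u, w) \<in> E \<longrightarrow> (v, w) \<in> E \<longrightarrow> rk w = Suc (rk u) \<longrightarrow> rk w = Suc (rk v) \<longrightarrow> u = v)"

lemma rankingD:
  assumes "ranking E rk"
  shows "(u, v) \<in> E \<Longrightarrow> rk v = Suc (rk u) \<or> rk u = Suc (rk v)"
    and "(u, w) \<in> E \<Longrightarrow> (v, w) \<in> E \<Longrightarrow> rk w = Suc (rk u) \<Longrightarrow> rk w = Suc (rk v) \<Longrightarrow> u = v"
  using assms unfolding ranking_def by blast+

lemma ranking_no_cycle:
  assumes "ranking E rk" "sym E"
  shows "\<not> has_cycle E"
proof
  assume "has_cycle E"
  then obtain c where c: "length c \<ge> 3" "distinct c"
    "\<And>i. i < length c \<Longrightarrow> (c ! i, c ! (Suc i mod length c)) \<in> E"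
    unfolding has_cycle_def by blast
  let ?n = "length c"
  have "Max (rk ` set c) \<in> rk ` set c" using c(1) by (intro Max_in) auto
  then obtain i where i: "i < ?n" "rk (c ! i) = Max (rk ` set c)" by (auto simp: in_set_conv_nth)
  define s where "s = Suc i mod ?n"
  define r where "r = (if i = 0 then ?n - 1 else i - 1)"
  have "?n > 0" using c(1) by linarith
  then have lt: "s < ?n" "r < ?n" using i(1) by (auto simp: s_def r_def)
  have "Suc r mod ?n = i" using i(1) c(1) by (auto simp: r_def)
  then have e: "(c ! r, c ! i) \<in> E" "(c ! s, c ! i) \<in> E" using c(3)[of r] c(3)[of i] i lt assms(2)
    by (auto simp: s_def sym_def)
  moreover have "rk (c ! r) \<le> rk (c ! i)" "rk (c ! s) \<le> rk (c ! i)" using lt i(2) by auto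
  ultimately have "rk (c ! i) = Suc (rk (c ! r))" "rk (c ! i) = Suc (rk (c ! s))"
    using rankingD(1)[OF assms(1)] by fastforce+
  then have "c ! r = c ! s" using rankingD(2)[OF assms(1)] e by blast
  then have "r = s" using lt c(2) nth_eq_iff_index_eq by blast
  then show False using i(1) c(1)
    by (cases "Suc i = ?n") (auto simp: r_def s_def split: if_splits)
qed

lemma has_cycleI:
  assumes "distinct c" "length c \<ge> 3" "successively (\<lambda>a b. (a, b) \<in> E) c" "(last c, hd c) \<in> E"
  shows "has_cycle E"
  unfolding has_cycle_def
proof (intro exI[of _ c] conjI allI impI assms(1,2))
  fix i assume i: "i < length c"
  show "(c ! i, c ! (Suc i mod length c)) \<in> E"
  proof (cases "Suc i < length c")
    case True
    then show ?thesis using assms(3) by (simp add: successively_conv_nth)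
  next
    case False
    then have "Suc i = length c" using i by simp
    moreover have "c \<noteq> []" using assms(2) by auto
    ultimately show ?thesis using assms(4) i by (simp add: last_conv_nth hd_conv_nth flip: \<open>Suc i = length c\<close>)
  qed
qed

lemma tree_ranking:
  assumes T: "is_tree V E" and r: "r \<in> V"
  obtains rk where "ranking E rk" "rk r = 0"
proof -
  have EV: "E \<subseteq> V \<times> V" and symE: "sym E" and irr: "irrefl E" and nc: "\<not> has_cycle E"
    and con: "\<And>v. v \<in> V \<Longrightarrow> (r, v) \<in> E\<^sup>*"
    using T r by (auto simp: is_tree_def)
  define d where "d v = (LEAST n. (r, v) \<in> E ^^ n)" for v
  have d: "(r, v) \<in> E ^^ d v" if "v \<in> V" for v
    unfolding d_def by (rule LeastI_ex) (use con[OF that] in \<open>simp add: rtrancl_power\<close>)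
  have d_le: "d v \<le> n" if "(r, v) \<in> E ^^ n" for v n
    unfolding d_def using that by (rule Least_le)
  have d_step: "d v \<le> Suc (d u)" if "(u, v) \<in> E" for u v
    using d[of u] that EV by (intro d_le) auto
  have d_r: "d r = 0" using d_le[of r 0] by simp
  have parent: "\<exists>u. (u, v) \<in> E \<and> d u = n" if "v \<in> V" "d v = Suc n" for v n
  proof -
    have "(r, v) \<in> E ^^ Suc n" using d[OF that(1)] that(2) by simp
    then obtain u where u: "(r, u) \<in> E ^^ n" "(u, v) \<in> E" by auto
    then have "d u \<le> n" "Suc n \<le> Suc (d u)" using d_le d_step[of u v] that(2) by auto
    then show ?thesis using u by auto
  qed
  have detour: "\<exists>q. q \<noteq> [] \<and> distinct (u # q @ [v]) \<and> (\<forall>z\<in>set q. d z < n) \<and>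
      successively (\<lambda>a b. (a, b) \<in> E) (u # q @ [v])"
    if "u \<in> V" "v \<in> V" "d u = n" "d v = n" "u \<noteq> v" for u v n
    using that
  proof (induction n arbitrary: u v)
    case 0
    then have "u = r" "v = r" using d[of u] d[of v] by auto
    then show ?case using 0 by simp
  next
    case (Suc n)
    obtain p where p: "(p, u) \<in> E" "d p = n" using parent Suc.prems by blast
    obtain p' where p': "(p', v) \<in> E" "d p' = n" using parent Suc.prems by blast
    have up: "(u, p) \<in> E" using p symE by (auto simp: sym_def)
    show ?case
    proof (cases "p = p'")
      case True
      then show ?thesis
        using up p p' Suc.prems by (intro exI[of _ "[p]"]) auto
    next
      case False
      then obtain q where q: "q \<noteq> []" "distinct (p # q @ [p'])" "\<forall>z\<in>set q. d z < n"
        "successively (\<lambda>a b. (a, b) \<in> E) (p # q @ [p'])"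
        using Suc.IH[of p p'] p p' EV by auto
      have "successively (\<lambda>a b. (a, b) \<in> E) (u # (p # q @ [p']) @ [v])"
        using q(1,4) up p' by (simp add: successively_append_iff successively_Cons)
      moreover have "distinct (u # (p # q @ [p']) @ [v])"
        using q(2,3) p(2) p'(2) Suc.prems by auto
      ultimately show ?thesis
        using q(3) p(2) p'(2) by (intro exI[of _ "p # q @ [p']"]) auto
    qed
  qed
  have neq: "d u \<noteq> d v" if uv: "(u, v) \<in> E" for u v
  proof
    assume "d u = d v"
    moreover have "u \<noteq> v" using uv irr by (auto simp: irrefl_def)
    ultimately obtain q where q: "q \<noteq> []" "distinct (u # q @ [v])"
      "successively (\<lambda>a b. (a, b) \<in> E) (u # q @ [v])"
      using detour[of u v "d v"] uv EV by auto
    have "has_cycle E"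
      by (rule has_cycleI[OF q(2) _ q(3)]) (use q(1) uv symE in \<open>auto simp: sym_def Suc_le_eq\<close>)
    then show False using nc by simp
  qed
  have uniq: "u = v" if E: "(u, w) \<in> E" "(v, w) \<in> E" and dw: "d w = Suc (d u)" "d w = Suc (d v)" for u v w
  proof (rule ccontr)
    assume "u \<noteq> v"
    then obtain q where q: "q \<noteq> []" "distinct (u # q @ [v])" "\<forall>z\<in>set q. d z < d u"
      "successively (\<lambda>a b. (a, b) \<in> E) (u # q @ [v])"
      using detour[of u v "d u"] E dw EV by auto
    have "has_cycle E"
    proof (rule has_cycleI)
      show "distinct (w # u # q @ [v])" using q(2,3) dw by auto
      show "successively (\<lambda>a b. (a, b) \<in> E) (w # u # q @ [v])" 
        using q(4) E symE by (auto simp: sym_def)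
    qed (use E symE in \<open>auto simp: sym_def\<close>)
    then show False using nc by simp
  qed
  have "ranking E d"
    unfolding ranking_def
  proof (intro conjI allI impI)
    fix u v assume uv: "(u, v) \<in> E"
    have "d v \<le> Suc (d u)" "d u \<le> Suc (d v)" using d_step uv symE by (auto simp: sym_def)
    then show "d v = Suc (d u) \<or> d u = Suc (d v)" using neq[OF uv] by linarith
  qed (use uniq in blast)
  then show ?thesis using that d_r by blast
qed

lemma is_treeI:
  assumes "E \<subseteq> V \<times> V" "sym E" "r \<in> V" "\<And>v. v \<in> V \<Longrightarrow> (r, v) \<in> E\<^sup>*" "ranking E rk"
  shows "is_tree V E"
  unfolding is_tree_def
proof (intro conjI ballI assms(1,2))
  show "irrefl E" using rankingD(1)[OF assms(5)] by (fastforce simp: irrefl_def)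
  show "V \<noteq> {}" using assms(3) by auto
  show "\<not> has_cycle E" using ranking_no_cycle assms by blast
  fix u v assume "u \<in> V" "v \<in> V"
  then show "(u, v) \<in> E\<^sup>*"
    using assms(4) sym_rtrancl[OF assms(2)] by (meson rtrancl_trans symD)
qed

lemma is_treeD:
  assumes "is_tree V E"
  shows "E \<subseteq> V \<times> V" "sym E" "irrefl E" "V \<noteq> {}" "\<not> has_cycle E"
    "u \<in> V \<Longrightarrow> v \<in> V \<Longrightarrow> (u, v) \<in> E\<^sup>*"
  using assms unfolding is_tree_def by auto

lemma rtrancl_image:
  assumes "(a, b) \<in> E\<^sup>*" "\<And>u v. (u, v) \<in> E \<Longrightarrow> (f u, f v) \<in> E'\<^sup>*"
  shows "(f a, f b) \<in> E'\<^sup>*"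
  using assms(1) by (induction) (auto intro: rtrancl_trans assms(2))

lemma bitreeD:
  assumes "bitree T"
  shows "finite (verts T)" "is_tree (verts T) (adj T)" "(lroot T, rroot T) \<in> adj T"
    "lroot T \<in> verts T" "rroot T \<in> verts T"
  using assms is_treeD(1)[of "verts T" "adj T"] unfolding bitree_def by auto

lemma is_tree_delete_leaf:
  assumes T: "is_tree V E" and a: "{v. (a, v) \<in> E} = {b}"
  shows "is_tree (V - {a}) {(u, v) \<in> E. u \<noteq> a \<and> v \<noteq> a}" (is "is_tree _ ?E")
proof -
  note T' = is_treeD[OF T]
  have b: "(a, b) \<in> E" "b \<in> V" "b \<noteq> a" and a': "\<And>v. (a, v) \<in> E \<Longrightarrow> v = b"
    using a T'(1,3) by (auto simp: irrefl_def)
  have a'': "\<And>v. (v, a) \<in> E \<Longrightarrow> v = b" using a' T'(2) by (auto simp: sym_def)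
  let ?f = "\<lambda>z. if z = a then b else z"
  have step: "(?f u, ?f v) \<in> ?E\<^sup>*" if "(u, v) \<in> E" for u v
  proof (cases "u = a \<or> v = a")
    case True
    then have "?f u = ?f v" using that a'[of v] a''[of u] by metis
    then show ?thesis by simp
  qed (use that in auto)
  have walk: "(?f u, ?f v) \<in> ?E\<^sup>*" if "u \<in> V" "v \<in> V" for u v
    using T'(6)[OF that] step by (rule rtrancl_image[where f = ?f])
  then have "(u, v) \<in> ?E\<^sup>*" if "u \<in> V - {a}" "v \<in> V - {a}" for u v
    using that walk[of u v] by simp
  moreover have "\<not> has_cycle ?E" using T'(5) unfolding has_cycle_def by blast
  ultimately show ?thesis
    using T'(1-3) b unfolding is_tree_def by (auto simp: sym_def irrefl_def)
qed

lemma bitree_delete_vertex: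
  assumes "bitree T" "thorn T a" "\<not> essential T a"
  shows "bitree (delete_vertex T a)"
proof -
  obtain b where b: "{v. (a, v) \<in> adj T} = {b}" using assms(2) by (auto simp: thorn_def)
  show ?thesis
    using is_tree_delete_leaf[OF bitreeD(2)[OF assms(1)] b] assms(3) bitreeD[OF assms(1)]
    by (auto simp: bitree_def delete_vertex_def essential_def)
qed

lemma bitree_merge:
  assumes T: "bitree T" and uv: "u \<noteq> v" "(u, w) \<in> adj T" "(v, w) \<in> adj T"
  shows "bitree (merge T u v)"
proof -
  note T' = is_treeD[OF bitreeD(2)[OF T]]
  define f where "f z = (if z = v then u else z)" for z
  let ?E = "map_prod f f ` adj T"
  have uvw: "u \<in> verts T" "v \<in> verts T" "w \<in> verts T" using uv T'(1) by auto
  obtain rk where rk: "ranking (adj T) rk" "rk w = 0"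
    using tree_ranking[OF bitreeD(2)[OF T] uvw(3)] by blast
  have "rk u = 1" "rk v = 1" using rankingD(1)[OF rk(1) uv(2)] rankingD(1)[OF rk(1) uv(3)] rk(2) by auto
  then have rk_f: "rk (f z) = rk z" for z by (simp add: f_def)
  have up: "z = w" if "(z, v) \<in> adj T" "rk v = Suc (rk z)" for z
    using rankingD(2)[OF rk(1) that(1), of w] uv(3) that T'(2) \<open>rk v = 1\<close> rk(2) by (auto simp: sym_def)
  have up': "z = w" if "(z, u) \<in> adj T" "rk u = Suc (rk z)" for z
    using rankingD(2)[OF rk(1) that(1), of w] uv(2) that T'(2) \<open>rk u = 1\<close> rk(2) by (auto simp: sym_def)
  have "ranking ?E rk"
    unfolding ranking_def
  proof (intro conjI allI impI)
    fix a b assume "(a, b) \<in> ?E"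
    then obtain a' b' where "(a', b') \<in> adj T" "a = f a'" "b = f b'" by auto
    then show "rk b = Suc (rk a) \<or> rk a = Suc (rk b)"
      using rankingD(1)[OF rk(1), of a' b'] rk_f[of a'] rk_f[of b'] by (simp only:)
  next
    fix a b c assume "(a, c) \<in> ?E" "(b, c) \<in> ?E" and r: "rk c = Suc (rk a)" "rk c = Suc (rk b)"
    then obtain a' c' b' c'' where e: "(a', c') \<in> adj T" "(b', c'') \<in> adj T"
      and eq: "a = f a'" "c = f c'" "b = f b'" "c = f c''" by auto
    have r': "rk c' = Suc (rk a')" "rk c'' = Suc (rk b')" using r eq rk_f by metis+
    have "a' = b'"
    proof (cases "c' = c''")
      case True
      then show ?thesis using rankingD(2)[OF rk(1)] e r' by blast
    next
      case False
      then have "c' = u \<and> c'' = v \<or> c' = v \<and> c'' = u" using eq(2,4) by (auto simp: f_def split: if_splits)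
      then show ?thesis using e r' up up' by blast
    qed
    then show "a = b" using eq by simp
  qed
  moreover have "(f w, z) \<in> ?E\<^sup>*" if z: "z \<in> f ` verts T" for z
  proof -
    obtain y where y: "y \<in> verts T" "z = f y" using z by blast
    have "(f w, f y) \<in> ?E\<^sup>*"
      using T'(6)[OF uvw(3) y(1)] by (rule rtrancl_image[where f = f]) (rule r_into_rtrancl, auto)
    then show ?thesis using y by simp
  qed
  moreover have "sym ?E" using T'(2) by (force simp: sym_def)
  moreover have "?E \<subseteq> f ` verts T \<times> f ` verts T" using T'(1) by force
  ultimately have "is_tree (f ` verts T) ?E"
    using uvw by (intro is_treeI[of _ _ "f w"]) auto
  moreover have "(f (lroot T), f (rroot T)) \<in> ?E" using bitreeD(3)[OF T] by auto
  moreover have "merge T u v = T\<lparr>verts := f ` verts T, adj := ?E, lroot := f (lroot T), rroot := f (rroot T)\<rparr>"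
    unfolding merge_def Let_def f_def ..
  ultimately show ?thesis using bitreeD(1)[OF T] by (simp add: bitree_def)
qed

lemma bitree_join:
  assumes S: "bitree S" and T: "bitree T"
  shows "bitree (join S T)"
proof -
  note S' = is_treeD[OF bitreeD(2)[OF S]] note T' = is_treeD[OF bitreeD(2)[OF T]]
  let ?f = "\<lambda>v::nat. 2 * v" and ?g = "\<lambda>v::nat. 2 * v + 1"
  let ?a = "?f (lroot S)" and ?b = "?g (rroot T)"
  let ?V = "?f ` verts S \<union> ?g ` verts T"
  let ?E = "map_prod ?f ?f ` adj S \<union> map_prod ?g ?g ` adj T \<union> {(?a, ?b), (?b, ?a)}"
  obtain rk where rk: "ranking (adj S) rk" "rk (lroot S) = 0"
    using tree_ranking[OF bitreeD(2,4)[OF S]] by blast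
  obtain rk' where rk': "ranking (adj T) rk'" "rk' (rroot T) = 0"
    using tree_ranking[OF bitreeD(2,5)[OF T]] by blast
  let ?rk = "\<lambda>v. if even v then rk (v div 2) else Suc (rk' (v div 2))"
  have "ranking ?E ?rk"
    unfolding ranking_def
  proof (intro conjI allI impI)
    fix u v assume "(u, v) \<in> ?E"
    then show "?rk v = Suc (?rk u) \<or> ?rk u = Suc (?rk v)"
      using rk(2) rk'(2) by (auto dest!: rankingD(1)[OF rk(1)] rankingD(1)[OF rk'(1)])
  next
    fix u v w assume e: "(u, w) \<in> ?E" "(v, w) \<in> ?E" and r: "?rk w = Suc (?rk u)" "?rk w = Suc (?rk v)"
    show "u = v"
    proof (cases "even w")
      case True
      have "\<exists>u'. u = ?f u' \<and> (u', w div 2) \<in> adj S \<and> rk (w div 2) = Suc (rk u')"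
        if "(u, w) \<in> ?E" "?rk w = Suc (?rk u)" for u
        using that True rk(2) by auto
      from this[OF e(1) r(1)] this[OF e(2) r(2)] show ?thesis using rankingD(2)[OF rk(1)] by blast
    next
      case False
      have "(\<exists>u'. u = ?g u' \<and> (u', w div 2) \<in> adj T \<and> rk' (w div 2) = Suc (rk' u')) \<or> u = ?a \<and> rk' (w div 2) = 0"
        if "(u, w) \<in> ?E" "?rk w = Suc (?rk u)" for u
        using that False rk(2) rk'(2) by auto
      from this[OF e(1) r(1)] this[OF e(2) r(2)] show ?thesis using rankingD(2)[OF rk'(1)] by auto
    qed
  qed
  moreover have "(?a, z) \<in> ?E\<^sup>*" if z: "z \<in> ?V" for z
  proof -
    consider y where "y \<in> verts S" "z = ?f y" | y where "y \<in> verts T" "z = ?g y" using z by blast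
    then show ?thesis
    proof cases
      case 1
      show ?thesis unfolding 1(2)
        using S'(6)[OF bitreeD(4)[OF S] 1(1)] by (rule rtrancl_image[where f = ?f]) (rule r_into_rtrancl, auto)
    next
      case 2
      have "(?b, z) \<in> ?E\<^sup>*" unfolding 2(2)
        using T'(6)[OF bitreeD(5)[OF T] 2(1)] by (rule rtrancl_image[where f = ?g]) (rule r_into_rtrancl, auto)
      then show ?thesis by (rule converse_rtrancl_into_rtrancl[rotated]) simp
    qed
  qed
  moreover have "sym ?E" using S'(2) T'(2) by (force simp: sym_def)
  moreover have "?E \<subseteq> ?V \<times> ?V" using S'(1) T'(1) bitreeD(4)[OF S] bitreeD(5)[OF T] by auto
  ultimately have "is_tree ?V ?E"
    using bitreeD(4)[OF S] by (intro is_treeI[of _ _ ?a ?rk]) auto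
  then show ?thesis using bitreeD(1)[OF S] bitreeD(1)[OF T]
    by (simp add: bitree_def join_def Let_def)
qed

section \<open>Denotations of bi-rooted trees\<close>

record ('v, 'a) lgraph =
  edge :: "'v \<Rightarrow> 'v \<Rightarrow> bool"
  mark :: "'v \<Rightarrow> 'a \<Rightarrow> bool"
  side :: "'v \<Rightarrow> bool"

text \<open>The last condition makes thorns invisible, the middle one foldings.\<close>

definition cover :: "('v, 'a) lgraph \<Rightarrow> bool" where
  "cover B \<longleftrightarrow>
     (\<forall>u v. edge B u v \<longrightarrow> edge B v u \<and> side B u \<noteq> side B v) \<and>
     (\<forall>u v w y. edge B v u \<longrightarrow> edge B v w \<longrightarrow> mark B u y \<longrightarrow> mark B w y \<longrightarrow> u = w) \<and>
     (\<forall>v y. mark B v y \<longrightarrow> (\<exists>w. edge B v w \<and> mark B w y))"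

lemma coverD:
  assumes "cover B"
  shows "edge B u v \<Longrightarrow> edge B v u"
    and "edge B u v \<Longrightarrow> side B v = (\<not> side B u)"
    and "edge B v u \<Longrightarrow> edge B v w \<Longrightarrow> mark B u y \<Longrightarrow> mark B w y \<Longrightarrow> u = w"
    and "mark B v y \<Longrightarrow> \<exists>w. edge B v w \<and> mark B w y"
  using assms unfolding cover_def by blast+

definition hom :: "'a bitree \<Rightarrow> ('v, 'a) lgraph \<Rightarrow> (nat \<Rightarrow> 'v) \<Rightarrow> bool" where
  "hom T B h \<longleftrightarrow> (\<forall>u v. (u, v) \<in> adj T \<longrightarrow> edge B (h u) (h v)) \<and>
     (\<forall>v\<in>verts T. mark B (h v) (lab T v))"

definition tree_den :: "'a bitree \<Rightarrow> ('v, 'a) lgraph \<Rightarrow> ('v \<times> 'v) set" where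
  "tree_den T B = {(h (lroot T), h (rroot T)) | h. hom T B h \<and> side B (h (lroot T))}"

lemma homD:
  assumes "hom T B h"
  shows "(u, v) \<in> adj T \<Longrightarrow> edge B (h u) (h v)" "v \<in> verts T \<Longrightarrow> mark B (h v) (lab T v)"
  using assms by (auto simp: hom_def)

lemma tree_den_extend_le:
  assumes "bitree T" and "\<And>h. hom S B h \<Longrightarrow> hom T B (h \<circ> f)" "f (lroot T) = lroot S" "f (rroot T) = rroot S"
  shows "tree_den S B \<subseteq> tree_den T B"
proof (clarsimp simp: tree_den_def)
  fix h assume "hom S B h" "side B (h (lroot S))"
  then show "\<exists>ha. h (lroot S) = ha (lroot T) \<and> h (rroot S) = ha (rroot T) \<and> hom T B ha \<and> side B (ha (lroot T))"
    using assms(2,3,4) by (intro exI[of _ "h \<circ> f"]) auto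
qed

lemma tree_den_iso:
  assumes "bitree S" "bitree T" "tree_iso S T"
  shows "tree_den S B = tree_den T B"
proof -
  have le: "tree_den T B \<subseteq> tree_den S B" if ST: "bitree S" "tree_iso S T" for S T
  proof -
    from ST(2) obtain f where f: "bij_betw f (verts S) (verts T)"
      "\<And>u v. u \<in> verts S \<Longrightarrow> v \<in> verts S \<Longrightarrow> (u, v) \<in> adj S \<longleftrightarrow> (f u, f v) \<in> adj T"
      "\<And>u. u \<in> verts S \<Longrightarrow> lab S u = lab T (f u)"
      "f (lroot S) = lroot T" "f (rroot S) = rroot T"
      unfolding tree_iso_def by blast
    have sub: "adj S \<subseteq> verts S \<times> verts S" using is_treeD(1)[OF bitreeD(2)[OF ST(1)]] .
    show ?thesis
    proof (rule tree_den_extend_le[OF ST(1) _ f(4,5)])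
      fix h assume h: "hom T B h"
      show "hom S B (h \<circ> f)"
        unfolding hom_def
      proof (intro conjI allI impI ballI)
        fix u v assume "(u, v) \<in> adj S"
        then show "edge B ((h \<circ> f) u) ((h \<circ> f) v)" using f(2)[of u v] homD(1)[OF h] sub by auto
      next
        fix v assume v: "v \<in> verts S"
        then have "f v \<in> verts T" using f(1) by (auto simp: bij_betw_def)
        then show "mark B ((h \<circ> f) v) (lab S v)" using f(3)[OF v] homD(2)[OF h] by simp
      qed
    qed
  qed
  show ?thesis
    using le[OF assms(1,3)] le[OF assms(2) tree_iso_sym[OF assms(3,1)]] by blast
qed

lemma hom_join:
  assumes "bitree S" "bitree T"
  shows "hom (join S T) B h \<longleftrightarrow> hom S B (\<lambda>v. h (2 * v)) \<and> hom T B (\<lambda>v. h (2 * v + 1)) \<and>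
     edge B (h (2 * lroot S)) (h (2 * rroot T + 1)) \<and> edge B (h (2 * rroot T + 1)) (h (2 * lroot S))"
  unfolding hom_def join_def Let_def by (simp add: ball_Un image_iff Bex_def map_prod_def) blast

lemma tree_den_join:
  assumes S: "bitree S" and T: "bitree T" and B: "cover B"
  shows "tree_den (join S T) B =
    {(u, v). edge B u v \<and> u \<in> Domain (tree_den S B) \<and> v \<in> Range (tree_den T B)}"
proof -
  have roots: "lroot (join S T) = 2 * lroot S" "rroot (join S T) = 2 * rroot T + 1"
    by (simp_all add: join_def Let_def)
  show ?thesis
  proof (intro equalityI subsetI)
    fix p assume "p \<in> tree_den (join S T) B"
    then obtain h where h: "p = (h (2 * lroot S), h (2 * rroot T + 1))" "hom (join S T) B h"
      "side B (h (2 * lroot S))" by (auto simp: tree_den_def roots)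
    have h': "hom S B (\<lambda>v. h (2 * v))" "hom T B (\<lambda>v. h (2 * v + 1))"
      "edge B (h (2 * lroot S)) (h (2 * rroot T + 1))" using h(2) hom_join[OF S T] by auto
    have "side B (h (2 * lroot T + 1))"
      using coverD(2)[OF B h'(3)] coverD(2)[OF B homD(1)[OF h'(2) bitreeD(3)[OF T]]] h(3) by simp
    then have "(h (2 * lroot T + 1), h (2 * rroot T + 1)) \<in> tree_den T B"
      using h'(2) by (auto simp: tree_den_def intro!: exI[of _ "\<lambda>v. h (2 * v + 1)"])
    moreover have "(h (2 * lroot S), h (2 * rroot S)) \<in> tree_den S B"
      using h'(1) h(3) by (auto simp: tree_den_def intro!: exI[of _ "\<lambda>v. h (2 * v)"])
    ultimately show "p \<in> {(u, v). edge B u v \<and> u \<in> Domain (tree_den S B) \<and> v \<in> Range (tree_den T B)}"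
      using h(1) h'(3) by blast
  next
    fix p assume "p \<in> {(u, v). edge B u v \<and> u \<in> Domain (tree_den S B) \<and> v \<in> Range (tree_den T B)}"
    then obtain f g where fg: "p = (f (lroot S), g (rroot T))" "edge B (f (lroot S)) (g (rroot T))"
      "hom S B f" "side B (f (lroot S))" "hom T B g"
      by (auto simp: tree_den_def)
    define h where "h v = (if even v then f (v div 2) else g (v div 2))" for v
    have "hom (join S T) B h"
      unfolding hom_join[OF S T] using fg coverD(1)[OF B fg(2)] by (simp add: h_def)
    then show "p \<in> tree_den (join S T) B"
      using fg by (auto simp: tree_den_def roots h_def intro!: exI[of _ h])
  qed
qed

lemma tree_den_delete_vertex:
  assumes T: "bitree T" "thorn T a" "\<not> essential T a" and B: "cover B"
  shows "tree_den (delete_vertex T a) B = tree_den T B"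
proof (intro equalityI subsetI)
  obtain b where b: "{v. (a, v) \<in> adj T} = {b}" "lab T a = lab T b" "a \<in> verts T"
    using T(2) by (auto simp: thorn_def)
  note T' = is_treeD[OF bitreeD(2)[OF T(1)]]
  have bv: "b \<in> verts T" "b \<noteq> a" using b T'(1,3) by (auto simp: irrefl_def)
  fix p assume "p \<in> tree_den (delete_vertex T a) B"
  then obtain h where h: "p = (h (lroot T), h (rroot T))" "hom (delete_vertex T a) B h"
    "side B (h (lroot T))" by (auto simp: tree_den_def delete_vertex_def)
  have "mark B (h b) (lab T a)" using h(2) bv b by (auto simp: hom_def delete_vertex_def)
  then obtain w where w: "edge B (h b) w" "mark B w (lab T a)" using coverD(4)[OF B] by blast
  have "hom T B (h(a := w))"
    unfolding hom_def
  proof (intro conjI allI impI ballI)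
    fix u v assume uv: "(u, v) \<in> adj T"
    then have vu: "(v, u) \<in> adj T" using T'(2) by (auto simp: sym_def)
    have "u \<noteq> v" using uv T'(3) by (auto simp: irrefl_def)
    consider "u = a" "v = b" | "v = a" "u = b" | "u \<noteq> a" "v \<noteq> a" using uv vu b(1) by blast
    then show "edge B ((h(a := w)) u) ((h(a := w)) v)"
      by cases (use w coverD(1)[OF B] bv uv h(2) in \<open>auto simp: hom_def delete_vertex_def\<close>)
  next
    fix v assume "v \<in> verts T"
    then show "mark B ((h(a := w)) v) (lab T v)"
      using w h(2) by (auto simp: hom_def delete_vertex_def)
  qed
  then show "p \<in> tree_den T B"
    using h T(3) by (auto simp: tree_den_def essential_def intro!: exI[of _ "h(a := w)"])
next
  fix p assume "p \<in> tree_den T B"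
  then show "p \<in> tree_den (delete_vertex T a) B"
    by (force simp: tree_den_def hom_def delete_vertex_def)
qed

lemma tree_den_merge:
  assumes T: "bitree T" and uv: "u \<noteq> v" "lab T u = lab T v" "(u, w) \<in> adj T" "(v, w) \<in> adj T" and B: "cover B"
  shows "tree_den (merge T u v) B = tree_den T B"
proof
  note T' = is_treeD[OF bitreeD(2)[OF T]]
  define f where "f z = (if z = v then u else z)" for z
  have m: "verts (merge T u v) = f ` verts T" "adj (merge T u v) = map_prod f f ` adj T"
    "lab (merge T u v) = lab T" "lroot (merge T u v) = f (lroot T)" "rroot (merge T u v) = f (rroot T)"
    unfolding merge_def Let_def f_def by simp_all
  have lab_f: "lab T (f z) = lab T z" for z using uv(2) by (simp add: f_def)
  show "tree_den (merge T u v) B \<subseteq> tree_den T B"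
  proof (rule tree_den_extend_le[OF T])
    fix h assume h: "hom (merge T u v) B h"
    show "hom T B (h \<circ> f)"
      unfolding hom_def
    proof (intro conjI allI impI ballI)
      fix x y assume "(x, y) \<in> adj T"
      then have "(f x, f y) \<in> adj (merge T u v)" unfolding m by force
      then show "edge B ((h \<circ> f) x) ((h \<circ> f) y)" using homD(1)[OF h] by simp
    next
      fix x assume "x \<in> verts T"
      then show "mark B ((h \<circ> f) x) (lab T x)"
        using homD(2)[OF h, of "f x"] lab_f by (simp add: m)
    qed
  qed (simp_all add: m)
  show "tree_den T B \<subseteq> tree_den (merge T u v) B"
  proof
    fix p assume "p \<in> tree_den T B"
    then obtain h where h: "p = (h (lroot T), h (rroot T))" "hom T B h" "side B (h (lroot T))"
      by (auto simp: tree_den_def)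
    have wu: "(w, u) \<in> adj T" "(w, v) \<in> adj T" "u \<in> verts T" "v \<in> verts T"
      using uv T'(1,2) by (auto simp: sym_def)
    have "h u = h v"
      using coverD(3)[OF B homD(1)[OF h(2) wu(1)] homD(1)[OF h(2) wu(2)]] homD(2)[OF h(2)] wu(3,4) uv(2)
      by metis
    then have hf: "h (f z) = h z" for z by (simp add: f_def)
    have "hom (merge T u v) B h"
      unfolding hom_def m using homD[OF h(2)] by (auto simp: hf lab_f)
    then show "p \<in> tree_den (merge T u v) B"
      using h by (auto simp: tree_den_def m hf intro!: exI[of _ h])
  qed
qed

lemma reduction_bitree: "reduction T T' \<Longrightarrow> bitree T \<Longrightarrow> bitree T'"
  by (induction rule: reduction.induct) (auto intro: bitree_delete_vertex bitree_merge)

lemma reduction_tree_den: "reduction T T' \<Longrightarrow> bitree T \<Longrightarrow> cover B \<Longrightarrow> tree_den T' B = tree_den T B"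
  by (induction rule: reduction.induct) (auto simp: tree_den_delete_vertex tree_den_merge)

lemma reduction_card:
  assumes "reduction T T'" "bitree T"
  shows "card (verts T') < card (verts T)"
  using assms
proof cases
  case (thorn_deletion a)
  then show ?thesis
    using bitreeD(1)[OF assms(2)] by (auto simp: delete_vertex_def thorn_def intro!: card_Diff1_less simp del: card_Diff_insert card_Diff_singleton)
next
  case (edge_folding u v w)
  have uv: "u \<in> verts T" "v \<in> verts T"
    using edge_folding is_treeD(1)[OF bitreeD(2)[OF assms(2)]] by auto
  then have "verts (merge T u v) = verts T - {v}"
    using edge_folding(2) unfolding merge_def Let_def by auto
  then show ?thesis
    unfolding edge_folding(1) using uv(2) bitreeD(1)[OF assms(2)] by (metis card_Diff1_less)
qed

lemma reductions_exist:
  assumes "bitree T"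
  shows "\<exists>U. reduction\<^sup>*\<^sup>* T U \<and> reduced U"
  using assms
proof (induction "card (verts T)" arbitrary: T rule: less_induct)
  case less
  show ?case
  proof (cases "reduced T")
    case False
    then obtain T' where T': "reduction T T'" by (auto simp: reduced_def)
    then obtain U where "reduction\<^sup>*\<^sup>* T' U" "reduced U"
      using less.hyps reduction_card[OF T' less.prems] reduction_bitree[OF T' less.prems] by blast
    then show ?thesis using T' by (meson converse_rtranclp_into_rtranclp)
  qed blast
qed

lemma reductions_bitree_den:
  assumes "reduction\<^sup>*\<^sup>* T U" "bitree T"
  shows "bitree U \<and> (cover B \<longrightarrow> tree_den U B = tree_den T B)"
  using assms by (induction) (auto simp: reduction_bitree reduction_tree_den)

definition thorned :: "'a bitree \<Rightarrow> (nat \<Rightarrow> bool) \<Rightarrow> (nat \<times> bool, 'a) lgraph" where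
  "thorned T c =
     \<lparr> edge = (\<lambda>(u, s) (v, t). \<not> s \<and> \<not> t \<and> (u, v) \<in> adj T \<or>
         u = v \<and> s \<noteq> t \<and> u \<in> verts T \<and> (\<forall>w. (u, w) \<in> adj T \<longrightarrow> lab T w \<noteq> lab T u)),
       mark = (\<lambda>(u, s) y. u \<in> verts T \<and> y = lab T u \<and>
         (s \<longrightarrow> (\<forall>w. (u, w) \<in> adj T \<longrightarrow> lab T w \<noteq> lab T u))),
       side = (\<lambda>(u, s). c u \<noteq> s) \<rparr>"

lemma cover_thorned:
  assumes "bitree T" "reduced T" and c: "\<And>u v. (u, v) \<in> adj T \<Longrightarrow> c u \<noteq> c v"
  shows "cover (thorned T c)"
proof -
  note T' = is_treeD[OF bitreeD(2)[OF assms(1)]]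
  have fold: "u = v" if "lab T u = lab T v" "(w, u) \<in> adj T" "(w, v) \<in> adj T" for u v w
    using assms(2) that T'(2) edge_folding[of u v T w] by (auto simp: reduced_def sym_def)
  show ?thesis
    unfolding cover_def
  proof (intro conjI allI impI)
    fix p q assume "edge (thorned T c) p q"
    then show "edge (thorned T c) q p" "side (thorned T c) p \<noteq> side (thorned T c) q"
      using T'(2) c by (auto simp: thorned_def sym_def)
  next
    fix p q r y
    assume "edge (thorned T c) q p" "edge (thorned T c) q r" "mark (thorned T c) p y" "mark (thorned T c) r y"
    then show "p = r" using fold by (auto simp: thorned_def)
  next
    fix p y assume m: "mark (thorned T c) p y"
    obtain u s where p: "p = (u, s)" by (cases p)
    show "\<exists>q. edge (thorned T c) p q \<and> mark (thorned T c) q y"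
    proof (cases "\<forall>w. (u, w) \<in> adj T \<longrightarrow> lab T w \<noteq> lab T u")
      case True
      then show ?thesis using m p by (intro exI[of _ "(u, \<not> s)"]) (auto simp: thorned_def)
    next
      case False
      then obtain w where "(u, w) \<in> adj T" "lab T w = lab T u" by blast
      then show ?thesis using m p T'(1) by (intro exI[of _ "(w, False)"]) (auto simp: thorned_def)
    qed
  qed
qed

lemma hom_thorned: "hom T (thorned T c) (\<lambda>v. (v, False))"
  by (auto simp: hom_def thorned_def)

lemma bitree_coloring:
  assumes "bitree T"
  obtains c where "\<And>u v. (u, v) \<in> adj T \<Longrightarrow> c u \<noteq> c v" "c (lroot T)"
proof -
  obtain rk where rk: "ranking (adj T) rk" "rk (lroot T) = 0"
    using tree_ranking[OF bitreeD(2,4)[OF assms]] by blast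
  have "even (rk u) \<noteq> even (rk v)" if "(u, v) \<in> adj T" for u v
    using rankingD(1)[OF rk(1) that] by auto
  then show ?thesis using that[of "\<lambda>v. even (rk v)"] rk(2) by auto
qed

text \<open>A homomorphism from a reduced tree cannot send a vertex to one of the added thorns unless the
  vertex is itself an essential thorn, whose image is a root.\<close>

lemma hom_thorned_real:
  assumes S: "bitree S" "reduced S" and T: "bitree T" and h: "hom S (thorned T c) h"
    and roots: "h (lroot S) = (lroot T, False)" "h (rroot S) = (rroot T, False)" and v: "v \<in> verts S"
  shows "h v = (fst (h v), False)"
proof (rule ccontr)
  note S' = is_treeD[OF bitreeD(2)[OF S(1)]]
  assume "\<not> ?thesis"
  then obtain t where t: "h v = (t, True)" by (cases "h v") auto
  then have nr: "\<not> essential S v" using roots by (auto simp: essential_def)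
  have nb: "h b = (t, False)" if "(v, b) \<in> adj S" for b
    using homD(1)[OF h that] t by (cases "h b") (auto simp: thorned_def)
  have lb: "lab S b = lab S v" if "(v, b) \<in> adj S" for b
    using homD(2)[OF h v] homD(2)[OF h, of b] nb[OF that] that t S'(1) by (auto simp: thorned_def)
  have "(v, lroot S) \<in> (adj S)\<^sup>*" using S'(6) v bitreeD(4)[OF S(1)] by blast
  then obtain b where b: "(v, b) \<in> adj S"
    using nr by (auto simp: essential_def elim: converse_rtranclE)
  have "b' = b" if "(v, b') \<in> adj S" for b'
  proof (rule ccontr)
    assume "b' \<noteq> b"
    then have "reduction S (merge S b' b)"
      using edge_folding[of b' b S v] b that lb[OF b] lb[OF that] symD[OF S'(2)] by simp
    then show False using S(2) unfolding reduced_def by blast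
  qed
  then have "{w. (v, w) \<in> adj S} = {b}" using b by blast
  then have "thorn S v" unfolding thorn_def using v lb[OF b] by (intro conjI exI[of _ b]) auto
  then show False using nr S(2) thorn_deletion unfolding reduced_def by blast
qed

lemma reduced_den_iso:
  assumes S: "bitree S" "reduced S" and T: "bitree T" "reduced T"
    and den: "\<And>B :: (nat \<times> bool, 'a) lgraph. cover B \<Longrightarrow> tree_den S B = tree_den T B"
  shows "tree_iso S (T :: 'a bitree)"
proof -
  have key: "\<exists>f. (\<forall>v\<in>verts S. f v \<in> verts T \<and> lab S v = lab T (f v)) \<and>
      (\<forall>u v. (u, v) \<in> adj S \<longrightarrow> (f u, f v) \<in> adj T) \<and> f (lroot S) = lroot T \<and> f (rroot S) = rroot T"
    if S: "bitree S" "reduced S" and T: "bitree T" "reduced T"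
      and den: "\<And>B :: (nat \<times> bool, 'a) lgraph. cover B \<Longrightarrow> tree_den S B = tree_den T B"
    for S T :: "'a bitree"
  proof -
    obtain c where c: "\<And>u v. (u, v) \<in> adj T \<Longrightarrow> c u \<noteq> c v" "c (lroot T)"
      using bitree_coloring[OF T(1)] by blast
    have "((lroot T, False), (rroot T, False)) \<in> tree_den T (thorned T c)"
      using hom_thorned[of T c] c(2) by (auto simp: tree_den_def thorned_def intro!: exI[of _ "\<lambda>v. (v, False)"])
    then have "((lroot T, False), (rroot T, False)) \<in> tree_den S (thorned T c)"
      using den[OF cover_thorned[OF T c(1)]] by simp
    then obtain h where h: "hom S (thorned T c) h" "h (lroot S) = (lroot T, False)" "h (rroot S) = (rroot T, False)"
      by (auto simp: tree_den_def)
    note real = hom_thorned_real[OF S T(1) h]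
    show ?thesis
    proof (intro exI[of _ "fst \<circ> h"] conjI ballI allI impI)
      fix v assume v: "v \<in> verts S"
      show "(fst \<circ> h) v \<in> verts T" "lab S v = lab T ((fst \<circ> h) v)"
        using homD(2)[OF h(1) v] real[OF v] by (auto simp: thorned_def split: prod.splits)
    next
      fix u v assume uv: "(u, v) \<in> adj S"
      then have "u \<in> verts S" "v \<in> verts S" using is_treeD(1)[OF bitreeD(2)[OF S(1)]] by auto
      then show "((fst \<circ> h) u, (fst \<circ> h) v) \<in> adj T"
        using homD(1)[OF h(1) uv] real[of u] real[of v] by (auto simp: thorned_def split: prod.splits)
    qed (use h in auto)
  qed
  have inv: "g (f v) = v"
    if S: "bitree S" "reduced S" and f: "\<And>u v. (u, v) \<in> adj S \<Longrightarrow> (f u, f v) \<in> adj T"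
      "\<And>v. v \<in> verts S \<Longrightarrow> f v \<in> verts T \<and> lab S v = lab T (f v)" "f (lroot S) = lroot T"
      and g: "\<And>u v. (u, v) \<in> adj T \<Longrightarrow> (g u, g v) \<in> adj S"
      "\<And>v. v \<in> verts T \<Longrightarrow> g v \<in> verts S \<and> lab T v = lab S (g v)" "g (lroot T) = lroot S"
      and v: "v \<in> verts S"
    for S T :: "'a bitree" and f g v
  proof -
    note S' = is_treeD[OF bitreeD(2)[OF S(1)]]
    have "(lroot S, v) \<in> (adj S)\<^sup>*" using S'(6) bitreeD(4)[OF S(1)] v by blast
    then show ?thesis
    proof (induction)
      case base
      then show ?case using f(3) g(3) by simp
    next
      case (step y z)
      have "(y, g (f z)) \<in> adj S" using f(1)[OF step(2)] g(1) step(3) by metis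
      moreover have "lab S (g (f z)) = lab S z" using f(2) g(2) step(2) S'(1) by (metis mem_Sigma_iff subsetD)
      ultimately show ?case
        using S(2) edge_folding[of "g (f z)" z S y] step(2) S'(2) by (auto simp: reduced_def sym_def)
    qed
  qed
  obtain f where f: "\<And>v. v \<in> verts S \<Longrightarrow> f v \<in> verts T \<and> lab S v = lab T (f v)"
    "\<And>u v. (u, v) \<in> adj S \<Longrightarrow> (f u, f v) \<in> adj T" "f (lroot S) = lroot T" "f (rroot S) = rroot T"
    using key[OF S T den] by blast
  obtain g where g: "\<And>v. v \<in> verts T \<Longrightarrow> g v \<in> verts S \<and> lab T v = lab S (g v)"
    "\<And>u v. (u, v) \<in> adj T \<Longrightarrow> (g u, g v) \<in> adj S" "g (lroot T) = lroot S" "g (rroot T) = rroot S"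
    using key[OF T S den[symmetric]] by blast
  have gf: "g (f v) = v" if "v \<in> verts S" for v
    by (rule inv[OF S f(2,1,3) g(2,1,3) that])
  have fg: "f (g v) = v" if "v \<in> verts T" for v
    by (rule inv[OF T g(2,1,3) f(2,1,3) that])
  have "bij_betw f (verts S) (verts T)"
    by (rule bij_betw_byWitness[of _ g]) (use f(1) g(1) fg gf in auto)
  then show ?thesis
    unfolding tree_iso_def using f g gf by (intro exI[of _ f]) metis
qed

section \<open>The free pseudosemilattice and its endomorphisms\<close>

lemma rep_free_psl: "bitree (rep_free_psl a)" "reduced (rep_free_psl a)" "abs_free_psl (rep_free_psl a) = a"
  using Quotient3_rep_reflp[OF Quotient3_free_psl, of a] Quotient3_abs_rep[OF Quotient3_free_psl, of a]
  by (auto simp: reduced_iso_def)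

lemma abs_free_psl_eq_iff:
  assumes "bitree S" "reduced S" "bitree T" "reduced T"
  shows "abs_free_psl S = abs_free_psl T \<longleftrightarrow> tree_iso S T"
  using Quotient3_rel[OF Quotient3_free_psl, of S T] assms tree_iso_refl by (auto simp: reduced_iso_def)

definition den :: "'a free_psl \<Rightarrow> ('v, 'a) lgraph \<Rightarrow> ('v \<times> 'v) set" where
  "den a = tree_den (rep_free_psl a)"

lemma den_abs:
  assumes "bitree T" "reduced T"
  shows "den (abs_free_psl T) B = tree_den T B"
proof -
  have "tree_iso (rep_free_psl (abs_free_psl T)) T"
    using abs_free_psl_eq_iff[OF rep_free_psl(1,2)[of "abs_free_psl T"] assms] rep_free_psl(3) by blast
  then show ?thesis unfolding den_def by (rule tree_den_iso[OF rep_free_psl(1) assms(1)])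
qed

lemma den_eqI:
  assumes "\<And>B :: (nat \<times> bool, 'a) lgraph. cover B \<Longrightarrow> den a B = den b B"
  shows "a = (b :: 'a free_psl)"
proof -
  have "tree_iso (rep_free_psl a) (rep_free_psl b)"
    by (rule reduced_den_iso[OF rep_free_psl(1,2) rep_free_psl(1,2)]) (use assms in \<open>simp add: den_def\<close>)
  then have "abs_free_psl (rep_free_psl a) = abs_free_psl (rep_free_psl b)"
    using abs_free_psl_eq_iff[OF rep_free_psl(1,2) rep_free_psl(1,2)] by blast
  then show ?thesis by (simp add: rep_free_psl)
qed

lemma reduced_form_eq:
  assumes T: "bitree T" and U: "reduction\<^sup>*\<^sup>* T U" "reduced U"
  shows "reduced_form T = abs_free_psl (U :: 'a bitree)"
  unfolding reduced_form_def
proof (rule the_equality)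
  fix c assume "\<exists>U. reduction\<^sup>*\<^sup>* T U \<and> reduced U \<and> c = abs_free_psl U"
  then obtain U' where U': "reduction\<^sup>*\<^sup>* T U'" "reduced U'" "c = abs_free_psl U'" by blast
  have bi: "bitree U'" "bitree U"
    using reductions_bitree_den[OF U'(1) T] reductions_bitree_den[OF U(1) T] by blast+
  have "tree_iso U' U"
    using reductions_bitree_den[OF U'(1) T] reductions_bitree_den[OF U(1) T] U'(2) U(2) bi
    by (intro reduced_den_iso) auto
  then show "c = abs_free_psl U"
    using abs_free_psl_eq_iff[OF bi(1) U'(2) bi(2) U(2)] U'(3) by simp
qed (use U in blast)

lemma den_reduced_form:
  assumes "bitree T" "cover B"
  shows "den (reduced_form T) B = tree_den T B"
proof -
  obtain U where U: "reduction\<^sup>*\<^sup>* T U" "reduced U" using reductions_exist[OF assms(1)] by blast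
  then show ?thesis
    using reductions_bitree_den[OF U(1) assms(1), of B] assms(2)
    by (simp add: reduced_form_eq[OF assms(1) U] den_abs)
qed

lemma den_meet:
  assumes "cover B"
  shows "den (meet a b) B = {(u, v). edge B u v \<and> u \<in> Domain (den a B) \<and> v \<in> Range (den b B)}"
  using tree_den_join[OF rep_free_psl(1) rep_free_psl(1) assms, of a b]
    den_reduced_form[OF bitree_join[OF rep_free_psl(1) rep_free_psl(1)] assms, of a b]
  by (simp add: meet_def den_def)

definition root_label :: "bool \<Rightarrow> 'a free_psl \<Rightarrow> 'a" where
  "root_label d a = lab (rep_free_psl a) (if d then lroot (rep_free_psl a) else rroot (rep_free_psl a))"

definition root_den :: "bool \<Rightarrow> 'a free_psl \<Rightarrow> ('v, 'a) lgraph \<Rightarrow> 'v set" where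
  "root_den d a B = (if d then Domain (den a B) else Range (den a B))"

lemma denD:
  assumes "(u, v) \<in> den a B" "cover B"
  shows "edge B u v" "side B u" "\<not> side B v" "mark B u (root_label True a)" "mark B v (root_label False a)"
proof -
  obtain h where h: "hom (rep_free_psl a) B h" "side B (h (lroot (rep_free_psl a)))"
    "u = h (lroot (rep_free_psl a))" "v = h (rroot (rep_free_psl a))"
    using assms(1) by (auto simp: den_def tree_den_def)
  show "edge B u v" using homD(1)[OF h(1) bitreeD(3)[OF rep_free_psl(1)]] h by simp
  then show "side B u" "\<not> side B v" using coverD(2)[OF assms(2), of u v] h by auto
  show "mark B u (root_label True a)" "mark B v (root_label False a)"
    using homD(2)[OF h(1)] bitreeD(4,5)[OF rep_free_psl(1)] h by (auto simp: root_label_def)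
qed

lemma root_denD:
  assumes "v \<in> root_den d a B" "cover B"
  shows "side B v = d" "mark B v (root_label d a)" "\<exists>w \<in> root_den (\<not> d) a B. edge B v w"
proof -
  consider w where "d" "(v, w) \<in> den a B" | w where "\<not> d" "(w, v) \<in> den a B"
    using assms(1) by (auto simp: root_den_def split: if_splits)
  then show "side B v = d" "mark B v (root_label d a)" "\<exists>w \<in> root_den (\<not> d) a B. edge B v w"
    by (cases; use denD[OF _ assms(2)] coverD(1)[OF assms(2)] in \<open>fastforce simp: root_den_def\<close>)+
qed

lemma root_den_side:
  assumes "cover B"
  shows "root_den d a B = {v. side B v = d \<and> v \<in> root_den (side B v) a B}"
  using root_denD(1)[OF _ assms] by blast

lemma den_root_den:
  assumes "cover B"
  shows "den a B = {(u, v). edge B u v \<and> u \<in> root_den True a B \<and> v \<in> root_den False a B}"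
proof (intro equalityI subsetI)
  fix p assume "p \<in> den a B"
  then show "p \<in> {(u, v). edge B u v \<and> u \<in> root_den True a B \<and> v \<in> root_den False a B}"
    using denD(1)[OF _ assms] by (cases p) (auto simp: root_den_def)
next
  fix p assume "p \<in> {(u, v). edge B u v \<and> u \<in> root_den True a B \<and> v \<in> root_den False a B}"
  then obtain u v where p: "p = (u, v)" "edge B u v" "u \<in> root_den True a B" "v \<in> root_den False a B" by blast
  obtain w where w: "(u, w) \<in> den a B" using p(3) by (auto simp: root_den_def)
  have "w = v"
    using coverD(3)[OF assms denD(1)[OF w assms] p(2) denD(5)[OF w assms] ] root_denD(2)[OF p(4) assms] by simp
  then show "p \<in> den a B" using w p by simp
qed

lemma free_psl_eqI:
  assumes "\<And>(B :: (nat \<times> bool, 'a) lgraph) d. cover B \<Longrightarrow> root_den d a B = root_den d b B"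
  shows "a = (b :: 'a free_psl)"
  by (rule den_eqI) (simp add: den_root_den assms)

text \<open>The meet with the factors exchanged when \<open>d\<close> is false, so that \<open>a\<close> always contributes the
  root on side \<open>d\<close> (true meaning left).\<close>

definition dmeet :: "bool \<Rightarrow> 'a free_psl \<Rightarrow> 'a free_psl \<Rightarrow> 'a free_psl" where
  "dmeet d a b = (if d then meet a b else meet b a)"

lemma root_den_meet:
  assumes "cover B"
  shows "root_den d (meet a b) B =
    (if d then {v \<in> root_den True a B. \<exists>w \<in> root_den False b B. edge B v w}
     else {w \<in> root_den False b B. \<exists>v \<in> root_den True a B. edge B v w})"
  by (auto simp: root_den_def den_meet[OF assms])

lemma root_den_dmeet:
  assumes "cover B"
  shows "root_den d (dmeet d a b) B = {v \<in> root_den d a B. \<exists>w \<in> root_den (\<not> d) b B. edge B v w}"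
    and "root_den (\<not> d) (dmeet d a b) B = {w \<in> root_den (\<not> d) b B. \<exists>v \<in> root_den d a B. edge B v w}"
  using coverD(1)[OF assms] by (auto simp: dmeet_def root_den_meet[OF assms])

definition gen_letter :: "'a \<Rightarrow> 'a free_psl" where
  "gen_letter y = abs_free_psl (letter y)"

lemma root_den_gen_letter:
  assumes "cover B"
  shows "root_den d (gen_letter y) B = {v. side B v = d \<and> mark B v y}"
proof -
  have "den (gen_letter y) B = {(u, v). edge B u v \<and> mark B u y \<and> mark B v y \<and> side B u}" (is "_ = ?R")
    unfolding gen_letter_def den_abs[OF letter_reduced]
  proof (intro equalityI subsetI)
    fix p assume "p \<in> tree_den (letter y) B"
    then show "p \<in> ?R" by (auto simp: tree_den_def hom_def letter_def)
  next
    fix p assume "p \<in> ?R"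
    then obtain u v where p: "p = (u, v)" "edge B u v" "mark B u y" "mark B v y" "side B u" by blast
    then have "hom (letter y) B (\<lambda>i. if i = 0 then u else v)"
      using coverD(1)[OF assms p(2)] by (simp add: hom_def letter_def)
    then show "p \<in> tree_den (letter y) B"
      using p by (auto simp: tree_den_def letter_def intro!: exI[of _ "\<lambda>i. if i = 0 then u else v"])
  qed
  then have iff: "v \<in> root_den d (gen_letter y) B \<longleftrightarrow> mark B v y \<and>
      (\<exists>w. mark B w y \<and> (if d then edge B v w \<and> side B v else edge B w v \<and> side B w))" for v
    by (auto simp: root_den_def)
  show ?thesis
  proof (intro set_eqI iffI)
    fix v assume "v \<in> root_den d (gen_letter y) B"
    then obtain w where "mark B v y" "if d then edge B v w \<and> side B v else edge B w v \<and> side B w"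
      unfolding iff by blast
    then show "v \<in> {v. side B v = d \<and> mark B v y}"
      using coverD(2)[OF assms, of w v] by (cases d) auto
  next
    fix v assume v: "v \<in> {v. side B v = d \<and> mark B v y}"
    then obtain w where w: "edge B v w" "mark B w y" using coverD(4)[OF assms] by blast
    then show "v \<in> root_den d (gen_letter y) B"
      unfolding iff using v coverD(1,2)[OF assms w(1)] by (intro conjI exI[of _ w]) (cases d; simp)+
  qed
qed

inductive generated :: "'a free_psl \<Rightarrow> bool" where
  generated_letter: "generated (gen_letter y)"
| generated_meet: "generated a \<Longrightarrow> generated b \<Longrightarrow> generated (meet a b)"

lemma generated_dmeet: "generated a \<Longrightarrow> generated b \<Longrightarrow> generated (dmeet d a b)"
  by (simp add: dmeet_def generated_meet)

text \<open>The tree \<open>T\<close>, viewed from its vertex \<open>z\<close> placed on either side, is denoted by a term in the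
  letters.\<close>

definition pointed :: "'a bitree \<Rightarrow> nat \<Rightarrow> bool" where
  "pointed T z \<longleftrightarrow> (\<forall>d. \<exists>c. generated c \<and> (\<forall>B :: (nat \<times> bool, 'a) lgraph. cover B \<longrightarrow>
     root_den d c B = {h z | h. hom T B h \<and> side B (h z) = d}))"

lemma pointed_step:
  assumes "pointed T z" "(z, w) \<in> adj T" "sym (adj T)" "w \<in> verts T"
  shows "pointed T w"
  unfolding pointed_def
proof (intro allI)
  fix d
  obtain c where c: "generated c" "\<And>B :: (nat \<times> bool, 'a) lgraph. cover B \<Longrightarrow>
    root_den (\<not> d) c B = {h z | h. hom T B h \<and> side B (h z) = (\<not> d)}"
    using assms(1) unfolding pointed_def by blast
  have wz: "(w, z) \<in> adj T" using assms(2,3) by (auto simp: sym_def)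
  have "root_den d (dmeet d (gen_letter (lab T w)) c) B = {h w | h. hom T B h \<and> side B (h w) = d}"
    if B: "cover B" for B :: "(nat \<times> bool, 'a) lgraph"
  proof -
    have "v = h w" if "hom T B h" "edge B v (h z)" "mark B v (lab T w)" for v h
      using coverD(3)[OF B coverD(1)[OF B that(2)] homD(1)[OF that(1) assms(2)] that(3)]
        homD(2)[OF that(1) assms(4)] .
    moreover have "edge B (h w) (h z)" "side B (h z) = (\<not> side B (h w))" "mark B (h w) (lab T w)"
      if "hom T B h" for h
      using homD(1)[OF that wz] coverD(2)[OF B] homD(2)[OF that assms(4)] by blast+
    ultimately show ?thesis
      unfolding root_den_dmeet(1)[OF B] root_den_gen_letter[OF B] c(2)[OF B] by blast
  qed
  then show "\<exists>c. generated c \<and> (\<forall>B :: (nat \<times> bool, 'a) lgraph. cover B \<longrightarrow>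
     root_den d c B = {h w | h. hom T B h \<and> side B (h w) = d})"
    using generated_dmeet[OF generated_letter c(1)] by blast
qed

lemma pointed_all:
  assumes T: "is_tree (verts T) (adj T)" and z: "pointed T z" "z \<in> verts T" "w \<in> verts T"
  shows "pointed T w"
  using is_treeD(6)[OF T z(2,3)]
proof induction
  case (step y w)
  then show ?case using pointed_step[OF step(3,2)] is_treeD(1,2)[OF T] by auto
qed (rule z)

lemma pointed_leaf:
  assumes T: "is_tree (verts T) (adj T)" and b: "{v. (a, v) \<in> adj T} = {b}"
    and del: "pointed (delete_vertex T a) b"
  shows "pointed T b"
  unfolding pointed_def
proof (intro allI)
  fix d
  note T' = is_treeD[OF T]
  have ab: "a \<in> verts T" "b \<in> verts T" "a \<noteq> b" "(b, a) \<in> adj T"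
    using b T'(1-3) by (auto simp: irrefl_def sym_def)
  obtain c where c: "generated c" "\<And>B :: (nat \<times> bool, 'a) lgraph. cover B \<Longrightarrow>
    root_den d c B = {h b | h. hom (delete_vertex T a) B h \<and> side B (h b) = d}"
    using del unfolding pointed_def by blast
  have "root_den d (dmeet d c (gen_letter (lab T a))) B = {h b | h. hom T B h \<and> side B (h b) = d}"
    (is "?L = ?R") if B: "cover B" for B :: "(nat \<times> bool, 'a) lgraph"
  proof (intro equalityI subsetI)
    fix p assume "p \<in> ?L"
    then obtain h w where h: "p = h b" "hom (delete_vertex T a) B h" "side B (h b) = d"
      "edge B (h b) w" "mark B w (lab T a)"
      unfolding root_den_dmeet(1)[OF B] root_den_gen_letter[OF B] c(2)[OF B] by blast
    have "hom T B (h(a := w))"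
      unfolding hom_def
    proof (intro conjI allI impI ballI)
      fix u v assume uv: "(u, v) \<in> adj T"
      then have vu: "(v, u) \<in> adj T" using T'(2) by (auto simp: sym_def)
      consider "u = a" "v = b" | "v = a" "u = b" | "u \<noteq> a" "v \<noteq> a" using uv vu b(1) by blast
      then show "edge B ((h(a := w)) u) ((h(a := w)) v)"
        by cases (use h(4) coverD(1)[OF B] ab uv h(2) in \<open>auto simp: hom_def delete_vertex_def\<close>)
    next
      fix v assume "v \<in> verts T"
      then show "mark B ((h(a := w)) v) (lab T v)"
        using h by (auto simp: hom_def delete_vertex_def)
    qed
    then show "p \<in> ?R" using h ab by (intro CollectI exI[of _ "h(a := w)"]) auto
  next
    fix p assume "p \<in> ?R"
    then obtain h where h: "p = h b" "hom T B h" "side B (h b) = d" by blast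
    then have "hom (delete_vertex T a) B h" by (auto simp: hom_def delete_vertex_def)
    moreover have "edge B (h b) (h a)" "mark B (h a) (lab T a)" "side B (h a) = (\<not> d)"
      using homD[OF h(2)] ab coverD(2)[OF B] h(3) by blast+
    ultimately show "p \<in> ?L"
      unfolding root_den_dmeet(1)[OF B] root_den_gen_letter[OF B] c(2)[OF B] using h by blast
  qed
  then show "\<exists>c. generated c \<and> (\<forall>B :: (nat \<times> bool, 'a) lgraph. cover B \<longrightarrow>
     root_den d c B = {h b | h. hom T B h \<and> side B (h b) = d})"
    using generated_dmeet[OF c(1) generated_letter] by blast
qed

lemma pointed_tree:
  assumes "is_tree (verts T) (adj T)" "finite (verts T)" "z \<in> verts T"
  shows "pointed T z"
  using assms
proof (induction "card (verts T)" arbitrary: T z rule: less_induct)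
  case less
  note T' = is_treeD[OF less.prems(1)]
  obtain rk where rk: "ranking (adj T) rk" "rk z = 0"
    using tree_ranking[OF less.prems(1,3)] by blast
  have "Max (rk ` verts T) \<in> rk ` verts T" using less.prems(2,3) by (intro Max_in) auto
  then obtain a where a: "a \<in> verts T" "rk a = Max (rk ` verts T)" by auto
  have nb: "rk a = Suc (rk b)" if "(a, b) \<in> adj T" for b
  proof -
    have "rk b \<le> rk a" using a less.prems(2) that T'(1) by auto
    then show ?thesis using rankingD(1)[OF rk(1) that] by auto
  qed
  show ?case
  proof (cases "a = z")
    case True
    then have iso: "(z, b) \<notin> adj T" for b using nb[of b] rk(2) by auto
    have only: "w = z" if "w \<in> verts T" for w
      using T'(6)[OF less.prems(3) that] by (rule converse_rtranclE) (use iso in auto)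
    then have "verts T = {z}" using less.prems(3) by blast
    moreover from this have "adj T = {}" using iso T'(1) by auto
    ultimately have "hom T B h \<longleftrightarrow> mark B (h z) (lab T z)" for h and B :: "(nat \<times> bool, 'a) lgraph"
      by (simp add: hom_def)
    then show ?thesis
      unfolding pointed_def
      by (intro allI exI[of _ "gen_letter (lab T z)"] conjI impI generated_letter)
        (auto simp: root_den_gen_letter intro: exI[of _ "\<lambda>_. _"])
  next
    case False
    then obtain b where b: "(a, b) \<in> adj T"
      using T'(6)[OF a(1) less.prems(3)] by (auto elim: converse_rtranclE)
    have "b' = b" if "(a, b') \<in> adj T" for b'
      using rankingD(2)[OF rk(1), of b' a b] nb[OF b] nb[OF that] b that T'(2) by (auto simp: sym_def)
    then have leaf: "{v. (a, v) \<in> adj T} = {b}" using b by blast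
    have bv: "b \<in> verts T - {a}" using b T'(1,3) by (auto simp: irrefl_def)
    have "0 < card (verts T)" using less.prems(2) a(1) by (auto simp: card_gt_0_iff)
    then have "pointed (delete_vertex T a) b"
      using is_tree_delete_leaf[OF less.prems(1) leaf] bv less.prems(2) a(1)
      by (intro less.hyps) (simp_all add: delete_vertex_def)
    from pointed_leaf[OF less.prems(1) leaf this] show ?thesis
      using pointed_all[OF less.prems(1), of b z] bv less.prems(3) by blast
  qed
qed

lemma generated_all: "generated (a :: 'a free_psl)"
proof -
  let ?T = "rep_free_psl a"
  note T = bitreeD[OF rep_free_psl(1), of a]
  note P = pointed_tree[OF T(2,1)]
  obtain c where c: "generated c" "\<And>B :: (nat \<times> bool, 'a) lgraph. cover B \<Longrightarrow>
    root_den True c B = {h (lroot ?T) | h. hom ?T B h \<and> side B (h (lroot ?T)) = True}"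
    using P[OF T(4)] unfolding pointed_def by blast
  obtain e where e: "generated e" "\<And>B :: (nat \<times> bool, 'a) lgraph. cover B \<Longrightarrow>
    root_den False e B = {h (rroot ?T) | h. hom ?T B h \<and> side B (h (rroot ?T)) = False}"
    using P[OF T(5)] unfolding pointed_def by blast
  have "den a B = den (meet c e) B" if B: "cover B" for B :: "(nat \<times> bool, 'a) lgraph"
  proof (intro equalityI subsetI)
    fix p assume "p \<in> den a B"
    then obtain h where h: "hom ?T B h" "side B (h (lroot ?T))" "p = (h (lroot ?T), h (rroot ?T))"
      by (auto simp: den_def tree_den_def)
    then have "h (lroot ?T) \<in> root_den True c B" "h (rroot ?T) \<in> root_den False e B"
      "edge B (h (lroot ?T)) (h (rroot ?T))"
      using c(2)[OF B] e(2)[OF B] homD(1)[OF h(1) T(3)] coverD(2)[OF B] by blast+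
    then show "p \<in> den (meet c e) B" by (simp add: den_meet[OF B] root_den_def h)
  next
    fix p assume "p \<in> den (meet c e) B"
    then obtain u v where p: "p = (u, v)" "edge B u v" "u \<in> root_den True c B" "v \<in> root_den False e B"
      unfolding den_meet[OF B] root_den_def if_True if_False by blast
    obtain h where h: "hom ?T B h" "side B (h (lroot ?T))" "u = h (lroot ?T)"
      using p(3) c(2)[OF B] by auto
    have "mark B v (lab ?T (rroot ?T))" using p(4) e(2)[OF B] homD(2) T(5) by fastforce
    then have "v = h (rroot ?T)"
      using coverD(3)[OF B p(2)[unfolded h(3)] homD(1)[OF h(1) T(3)]] homD(2)[OF h(1) T(5)] by blast
    then show "p \<in> den a B" using h p by (auto simp: den_def tree_den_def)
  qed
  then have "a = meet c e" by (rule den_eqI)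
  then show ?thesis using generated_meet[OF c(1) e(1)] by simp
qed

text \<open>Substituting \<open>g\<close> and interpreting in \<open>B\<close> is the same as interpreting in \<open>B\<close> with the letter
  \<open>y\<close> put on the vertices that are images of the root of \<open>g y\<close>. The result is again a cover, even though
  a vertex may now carry many letters.\<close>

definition subst_graph :: "('a \<Rightarrow> 'a free_psl) \<Rightarrow> ('v, 'a) lgraph \<Rightarrow> ('v, 'a) lgraph" where
  "subst_graph g B = B\<lparr>mark := \<lambda>v y. v \<in> root_den (side B v) (g y) B\<rparr>"

lemma subst_graph_simps [simp]:
  "edge (subst_graph g B) = edge B" "side (subst_graph g B) = side B"
  "mark (subst_graph g B) v y \<longleftrightarrow> v \<in> root_den (side B v) (g y) B"
  by (simp_all add: subst_graph_def)

lemma cover_subst_graph: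
  assumes B: "cover B"
  shows "cover (subst_graph g B)"
  unfolding cover_def subst_graph_simps
proof (intro conjI allI impI)
  fix u v assume "edge B u v"
  then show "edge B v u" "side B u \<noteq> side B v" using coverD(1,2)[OF B] by blast+
next
  fix u v w y
  assume *: "edge B v u" "edge B v w" "u \<in> root_den (side B u) (g y) B" "w \<in> root_den (side B w) (g y) B"
  then have "side B u = side B w" using coverD(2)[OF B] by blast
  then show "u = w"
    using coverD(3)[OF B *(1,2) root_denD(2)[OF *(3) B]] root_denD(2)[OF *(4) B] by simp
next
  fix v y assume "v \<in> root_den (side B v) (g y) B"
  from root_denD(3)[OF this B] obtain w where "w \<in> root_den (\<not> side B v) (g y) B" "edge B v w" by blast
  then show "\<exists>w. edge B v w \<and> w \<in> root_den (side B w) (g y) B" using coverD(2)[OF B, of v w] by auto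
qed

lemma root_den_endomorphism:
  assumes \<phi>: "endomorphism \<phi>" and B: "cover B"
  shows "root_den d (\<phi> a) B = root_den d a (subst_graph (\<lambda>y. \<phi> (gen_letter y)) B)"
  using generated_all[of a]
proof (induction arbitrary: d)
  case (generated_letter y)
  show ?case
    by (simp add: root_den_gen_letter[OF cover_subst_graph[OF B]] flip: root_den_side[OF B])
next
  case (generated_meet a b)
  then show ?case
    using \<phi> by (simp add: endomorphism_def root_den_meet[OF B] root_den_meet[OF cover_subst_graph[OF B]])
qed

lemma endomorphism_exists:
  obtains \<phi> where "endomorphism \<phi>" "\<And>y. \<phi> (gen_letter y) = (g y :: 'a free_psl)"
proof -
  have ex: "\<exists>c. \<forall>d (B :: (nat \<times> bool, 'a) lgraph). cover B \<longrightarrow> root_den d c B = root_den d a (subst_graph g B)" for a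
    using generated_all[of a]
  proof induction
    case (generated_letter y)
    show ?case
      by (intro exI[of _ "g y"]) (simp add: root_den_gen_letter[OF cover_subst_graph] flip: root_den_side)
  next
    case (generated_meet a b)
    then obtain c e where "\<forall>d (B :: (nat \<times> bool, 'a) lgraph). cover B \<longrightarrow> root_den d c B = root_den d a (subst_graph g B)"
      "\<forall>d (B :: (nat \<times> bool, 'a) lgraph). cover B \<longrightarrow> root_den d e B = root_den d b (subst_graph g B)"
      by blast
    then show ?case
      by (intro exI[of _ "meet c e"]) (simp add: root_den_meet root_den_meet[OF cover_subst_graph])
  qed
  define \<phi> where "\<phi> a = (SOME c. \<forall>d (B :: (nat \<times> bool, 'a) lgraph). cover B \<longrightarrow> root_den d c B = root_den d a (subst_graph g B))" for a
  have \<phi>: "root_den d (\<phi> a) B = root_den d a (subst_graph g B)" if "cover B" for d a and B :: "(nat \<times> bool, 'a) lgraph"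
    using someI_ex[OF ex[of a]] that unfolding \<phi>_def by blast
  have "endomorphism \<phi>"
    unfolding endomorphism_def
  proof (intro allI)
    fix a b
    show "\<phi> (meet a b) = meet (\<phi> a) (\<phi> b)"
      by (rule free_psl_eqI) (simp add: \<phi> root_den_meet root_den_meet[OF cover_subst_graph])
  qed
  moreover have "\<phi> (gen_letter y) = g y" for y
    by (rule free_psl_eqI) (simp add: \<phi> root_den_gen_letter[OF cover_subst_graph] flip: root_den_side)
  ultimately show ?thesis using that by blast
qed

definition root_pairs :: "bool \<Rightarrow> 'a free_psl \<Rightarrow> ('v, 'a) lgraph \<Rightarrow> ('v \<times> 'v) set" where
  "root_pairs d a B = (if d then den a B else (den a B)\<inverse>)"

lemma root_pairs_root_den:
  assumes "cover B"
  shows "root_pairs d a B = {(u, v). edge B u v \<and> u \<in> root_den d a B \<and> v \<in> root_den (\<not> d) a B}"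
  using coverD(1)[OF assms] by (cases d) (auto simp: root_pairs_def den_root_den[OF assms])

lemma root_den_root_pairs:
  "root_den d a B = Domain (root_pairs d a B)" "root_den (\<not> d) a B = Range (root_pairs d a B)"
  by (auto simp: root_pairs_def root_den_def)

lemma free_psl_root_pairs_eqI:
  assumes "\<And>B :: (nat \<times> bool, 'a) lgraph. cover B \<Longrightarrow> root_pairs d a B = root_pairs d b B"
  shows "a = (b :: 'a free_psl)"
proof (rule den_eqI)
  fix B :: "(nat \<times> bool, 'a) lgraph" assume "cover B"
  from assms[OF this] show "den a B = den b B" by (cases d) (simp_all add: root_pairs_def)
qed

lemma root_pairs_dmeet:
  assumes "cover B"
  shows "root_pairs d (dmeet d a b) B = {(u, v). edge B u v \<and> u \<in> root_den d a B \<and> v \<in> root_den (\<not> d) b B}"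
    and "root_pairs (\<not> d) (dmeet d a b) B = {(v, u). edge B v u \<and> u \<in> root_den d a B \<and> v \<in> root_den (\<not> d) b B}"
  using coverD(1)[OF assms]
  by (auto simp: root_pairs_root_den[OF assms] root_den_dmeet[OF assms])

section \<open>Deriving the identities\<close>

definition path_index :: "nat \<Rightarrow> nat \<Rightarrow> nat" where
  "path_index n p = (if 2 * n dvd p then 2 * n else p mod (2 * n))"

text \<open>Here \<open>d\<close> is the side of the root \<open>a\<^sub>1\<close>.\<close>

definition alphad :: "bool \<Rightarrow> (nat \<Rightarrow> 'a) \<Rightarrow> nat \<Rightarrow> nat \<Rightarrow> nat \<Rightarrow> 'a free_psl" where
  "alphad d x n k i = (if d then alpha x n k i else alpha_star x n k i)"

definition betad :: "bool \<Rightarrow> (nat \<Rightarrow> 'a) \<Rightarrow> nat \<Rightarrow> nat \<Rightarrow> nat \<Rightarrow> 'a free_psl" where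
  "betad d x n k i = (if d then beta x n k i else beta_star x n k i)"

definition walk :: "('v, 'a) lgraph \<Rightarrow> nat \<Rightarrow> nat \<Rightarrow> (nat \<Rightarrow> 'a) \<Rightarrow> (nat \<Rightarrow> 'v) \<Rightarrow> bool" where
  "walk B a N y w \<longleftrightarrow> (\<forall>p\<in>{a..N}. mark B (w p) (y p)) \<and> (\<forall>p\<in>{a..<N}. edge B (w p) (w (Suc p)))"

lemma walkD:
  assumes "walk B a N y w"
  shows "a \<le> p \<Longrightarrow> p \<le> N \<Longrightarrow> mark B (w p) (y p)" "a \<le> p \<Longrightarrow> p < N \<Longrightarrow> edge B (w p) (w (Suc p))"
  using assms by (auto simp: walk_def)

lemma walk_side:
  assumes "walk B a N y w" "cover B" "a \<le> p" "p \<le> N"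
  shows "side B (w p) = (side B (w a) = (even (p - a)))"
  using assms(3,4)
proof (induction p rule: dec_induct)
  case (step p)
  then show ?case using coverD(2)[OF assms(2) walkD(2)[OF assms(1), of p]] by (simp add: Suc_diff_le)
qed simp

lemma hom_path:
  assumes "cover B" "verts T = {a..N}" "adj T = {(p, q) \<in> {a..N} \<times> {a..N}. q = Suc p \<or> p = Suc q}"
  shows "hom T B w \<longleftrightarrow> walk B a N (lab T) w"
  using coverD(1)[OF assms(1)] unfolding hom_def walk_def assms(2,3) by auto

lemma tree_den_swap_roots:
  assumes "bitree T" "cover B"
  shows "tree_den (swap_roots T) B = {(h (rroot T), h (lroot T)) | h. hom T B h \<and> \<not> side B (h (lroot T))}"
proof -
  have "hom (swap_roots T) B h \<longleftrightarrow> hom T B h" for h by (simp add: hom_def swap_roots_def)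
  moreover have "side B (h (rroot T)) \<longleftrightarrow> \<not> side B (h (lroot T))" if "hom T B h" for h
    using coverD(2)[OF assms(2) homD(1)[OF that bitreeD(3)[OF assms(1)]]] .
  ultimately show ?thesis by (auto simp: tree_den_def) (auto simp: swap_roots_def)
qed

lemma root_pairs_alpha_beta:
  assumes x: "inj_on x {1..}" "n \<ge> 2" "k \<ge> 1" and B: "cover B"
  shows "root_pairs d (alphad d x n k i) B =
      {(w 1, w 2) | w. walk B 1 (2 * n * k + i) (x \<circ> path_index n) w \<and> side B (w 1) = d}"
    and "root_pairs d (betad d x n k i) B =
      {(w 1, w 2) | w. walk B 0 (2 * n * k + i) (x \<circ> path_index n) w \<and> side B (w 1) = d}"
proof -
  note r = alpha_beta_reduced[OF x, of i] and b = alpha_beta_bitree[OF x(2,3), of x i]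
  have hom: "hom (alpha_tree x n k i) B w \<longleftrightarrow> walk B 1 (2 * n * k + i) (x \<circ> path_index n) w"
    "hom (beta_tree x n k i) B w \<longleftrightarrow> walk B 0 (2 * n * k + i) (x \<circ> path_index n) w" for w
    using hom_path[OF B, of "alpha_tree x n k i" 1 "2 * n * k + i" w]
      hom_path[OF B, of "beta_tree x n k i" 0 "2 * n * k + i" w]
    by (simp_all add: alpha_tree_def beta_tree_eq[OF x(2,3)] Let_def path_index_def comp_def)
  have roots: "lroot (alpha_tree x n k i) = 1" "rroot (alpha_tree x n k i) = 2"
    "lroot (beta_tree x n k i) = 1" "rroot (beta_tree x n k i) = 2"
    by (simp_all add: alpha_tree_def beta_tree_def Let_def)
  show "root_pairs d (alphad d x n k i) B =
      {(w 1, w 2) | w. walk B 1 (2 * n * k + i) (x \<circ> path_index n) w \<and> side B (w 1) = d}"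
    by (cases d) (auto simp: root_pairs_def alphad_def alpha_def alpha_star_def den_abs[OF b(1) r(1)]
      den_abs[OF swap_roots_bitree[OF b(1)] swap_roots_reduced[OF r(1)]] tree_den_swap_roots[OF b(1) B]
      tree_den_def[of "alpha_tree x n k i"] hom roots)
  show "root_pairs d (betad d x n k i) B =
      {(w 1, w 2) | w. walk B 0 (2 * n * k + i) (x \<circ> path_index n) w \<and> side B (w 1) = d}"
    by (cases d) (auto simp: root_pairs_def betad_def beta_def beta_star_def den_abs[OF b(2) r(2)]
      den_abs[OF swap_roots_bitree[OF b(2)] swap_roots_reduced[OF r(2)]] tree_den_swap_roots[OF b(2) B]
      tree_den_def[of "beta_tree x n k i"] hom roots)
qed

lemma path_index_eq:
  assumes "1 \<le> s" "s \<le> 2 * n"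
  shows "path_index n (2 * n * t + s) = s"
proof (cases "s = 2 * n")
  case False
  then have "s < 2 * n" using assms by simp
  moreover have "\<not> 2 * n dvd s" using assms False by (auto dest: dvd_imp_le)
  ultimately show ?thesis using dvd_add_right_iff[of "2 * n" "2 * n * t" s] by (simp add: path_index_def)
qed (simp add: path_index_def)

lemma path_decomp:
  fixes n p :: nat
  assumes "1 \<le> p" "1 \<le> n"
  obtains t q where "p = 2 * n * t + q" "1 \<le> q" "q \<le> 2 * n"
proof
  show "p = 2 * n * ((p - 1) div (2 * n)) + ((p - 1) mod (2 * n) + 1)"
    using assms(1) mult_div_mod_eq[of "2 * n" "p - 1"] by linarith
qed (use assms in \<open>auto simp: Suc_le_eq\<close>)

lemma path_decomp_div:
  fixes n q t :: nat
  assumes "1 \<le> q" "q \<le> 2 * n"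
  shows "(2 * n * t + q - 1) div (2 * n) = t"
proof -
  have "2 * n * t + q - 1 = (q - 1) + t * (2 * n)" using assms by (simp add: ac_simps)
  moreover have "2 * n \<noteq> 0" "(q - 1) div (2 * n) = 0" using assms by (auto intro: div_less)
  ultimately show ?thesis using div_mult_self1[of "2 * n" "q - 1" t] by presburger
qed

text \<open>A walk may pause at the vertex \<open>w (c p)\<close> by alternating between it and the thorn there;
  \<open>\<tau> p\<close> says that it is on the thorn.\<close>

lemma stretched_walk:
  assumes B: "cover B" and w: "walk B 1 N' y w"
    and c: "\<And>p. 1 \<le> p \<Longrightarrow> p \<le> N \<Longrightarrow> 1 \<le> c p \<and> c p \<le> N'"
    and step: "\<And>p. 1 \<le> p \<Longrightarrow> p < N \<Longrightarrow> c (Suc p) = c p \<and> \<tau> p \<noteq> \<tau> (Suc p) \<or>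
      c (Suc p) = Suc (c p) \<and> \<not> \<tau> p \<and> \<not> \<tau> (Suc p)"
  shows "\<exists>v. walk B 1 N (y \<circ> c) v \<and> (\<forall>p. \<not> \<tau> p \<longrightarrow> v p = w (c p)) \<and>
    (\<forall>p\<in>{1..N}. \<tau> p \<longrightarrow> edge B (v p) (w (c p)))"
proof -
  have "\<forall>p\<in>{1..N'}. \<exists>t. edge B (w p) t \<and> mark B t (y p)"
    using coverD(4)[OF B] walkD(1)[OF w] by auto
  then obtain t where t: "\<And>p. 1 \<le> p \<Longrightarrow> p \<le> N' \<Longrightarrow> edge B (w p) (t p) \<and> mark B (t p) (y p)"
    by (metis atLeastAtMost_iff)
  define v where "v p = (if \<tau> p then t (c p) else w (c p))" for p
  have "walk B 1 N (y \<circ> c) v"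
    unfolding walk_def
  proof (intro conjI ballI)
    fix p assume p: "p \<in> {1..N}"
    then show "mark B (v p) ((y \<circ> c) p)" using t[of "c p"] walkD(1)[OF w, of "c p"] c[of p] by (simp add: v_def)
  next
    fix p assume p: "p \<in> {1..<N}"
    then have cp: "1 \<le> c p" "c p \<le> N'" "c (Suc p) \<le> N'" using c[of p] c[of "Suc p"] by auto
    from p step[of p] consider "c (Suc p) = c p" "\<tau> p \<noteq> \<tau> (Suc p)" |
      "c (Suc p) = Suc (c p)" "\<not> \<tau> p" "\<not> \<tau> (Suc p)" by auto
    then show "edge B (v p) (v (Suc p))"
    proof cases
      case 1
      then show ?thesis using t[OF cp(1,2)] coverD(1)[OF B] by (auto simp: v_def)
    next
      case 2
      then show ?thesis using walkD(2)[OF w, of "c p"] cp by (simp add: v_def)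
    qed
  qed
  moreover have "\<forall>p\<in>{1..N}. \<tau> p \<longrightarrow> edge B (v p) (w (c p))"
    using t c coverD(1)[OF B] by (simp add: v_def)
  ultimately show ?thesis by (intro exI[of _ v]) (simp add: v_def)
qed

lemma consequenceI:
  assumes "\<And>\<theta>. congruence \<theta> \<Longrightarrow> fully_invariant \<theta> \<Longrightarrow> \<tau> \<in> \<theta> \<Longrightarrow> \<sigma> \<in> \<theta>"
  shows "\<sigma> is_consequence_of \<tau>"
  using assms by (auto simp: is_consequence_of_def fully_invariant_congruence_generated_def)

lemma congruence_refl: "congruence \<theta> \<Longrightarrow> (a, a) \<in> \<theta>"
  by (auto simp: congruence_def equiv_def refl_on_def)

lemma congruence_dmeet:
  "congruence \<theta> \<Longrightarrow> (a, b) \<in> \<theta> \<Longrightarrow> (c, e) \<in> \<theta> \<Longrightarrow> (dmeet d a c, dmeet d b e) \<in> \<theta>"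
  by (simp add: congruence_def dmeet_def)

lemma substitution_on_letters:
  assumes "inj_on x {1..}"
  obtains g where "\<And>q. 1 \<le> q \<Longrightarrow> g (x q) = G q"
proof
  show "1 \<le> q \<Longrightarrow> (G \<circ> inv_into {1..} x) (x q) = G q" for q
    using assms by simp
qed

lemma path_index_range: "1 \<le> n \<Longrightarrow> 1 \<le> path_index n p \<and> path_index n p \<le> 2 * n"
  using mod_less_divisor[of "2 * n" p] by (auto simp: path_index_def Suc_le_eq mod_greater_zero_iff_not_dvd)

text \<open>The walk that reads \<open>2m\<close> letters of the target path in \<open>2n\<close> steps, pausing at the
  beginning of each period.\<close>

lemma consequence_same_side:
  assumes x: "inj_on x {1..}" and nm: "2 \<le> m" "m \<le> n" and kl: "1 \<le> k" "k \<le> l"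
    and ij: "1 \<le> i" "i \<le> 2 * n" "1 \<le> j" "l = k \<Longrightarrow> i + 2 * m \<le> j + 2 * n"
  shows "(alphad d x m l j, betad d x m l j) is_consequence_of (alphad d x n k i, betad d x n k i)"
proof (rule consequenceI)
  fix \<theta> assume \<theta>: "congruence \<theta>" "fully_invariant \<theta>" "(alphad d x n k i, betad d x n k i) \<in> \<theta>"
  let ?N = "2 * n * k + i" and ?M = "2 * m * l + j" and ?T = "alphad d x m l j"
  define e where "e = 2 * (n - m)"
  have e: "2 * n = e + 2 * m" "even e" using nm by (auto simp: e_def)
  define s where "s q = max 1 (q - e)" for q
  obtain g where g: "\<And>q. 1 \<le> q \<Longrightarrow> g (x q) = gen_letter (x (s q))"
    using substitution_on_letters[OF x, of "\<lambda>q. gen_letter (x (s q))"] by blast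
  obtain \<phi> where \<phi>: "endomorphism \<phi>" "\<And>y. \<phi> (gen_letter y) = g y"
    using endomorphism_exists by blast
  have n: "2 \<le> n" "1 \<le> l" using nm kl by auto
  have N: "2 \<le> ?N" "2 \<le> ?M"
    using mult_le_mono[of 2 n 1 k] mult_le_mono[of 2 m 1 l] n nm kl by linarith+
  define c where "c p = 2 * m * ((p - 1) div (2 * n)) + s (path_index n p)" for p
  define \<tau> where "\<tau> p = (path_index n p \<le> e \<and> even (path_index n p))" for p
  have cq: "c (2 * n * t + q) = 2 * m * t + s q" "\<tau> (2 * n * t + q) = (q \<le> e \<and> even q)"
    if "1 \<le> q" "q \<le> 2 * n" for t q
    using that by (simp_all add: c_def \<tau>_def path_index_eq path_decomp_div del: One_nat_def)
  have s: "1 \<le> s q" "s q \<le> 2 * m" if "q \<le> 2 * n" for q using that e nm by (auto simp: s_def)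
  have stretch: "\<exists>v. walk (subst_graph g B) 1 ?N (x \<circ> path_index n) v \<and> v 1 = w 1"
    if B: "cover B" and w: "walk B 1 ?M (x \<circ> path_index m) w" for B :: "(nat \<times> bool, 'a) lgraph" and w
  proof -
    have bound: "1 \<le> c p \<and> c p \<le> ?M" if p: "1 \<le> p" "p \<le> ?N" for p
    proof -
      obtain t q where tq: "p = 2 * n * t + q" "1 \<le> q" "q \<le> 2 * n"
        using path_decomp[OF p(1), of n] n by auto
      have "2 * n * t < 2 * n * (k + 1)" using p(2) tq ij by (simp add: algebra_simps)
      then have tk: "t \<le> k" by (simp only: mult_less_cancel1) simp
      have "2 * m * t + s q \<le> ?M"
      proof (cases "t < l")
        case True
        then have "2 * m * (t + 1) \<le> 2 * m * l" by (intro mult_le_mono) auto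
        then show ?thesis using s(2)[OF tq(3)] by simp
      next
        case False
        then have "t = k" "l = k" using tk kl by auto
        then show ?thesis using p(2) tq e ij(3) ij(4) by (auto simp: s_def)
      qed
      then show ?thesis using cq(1)[OF tq(2,3)] s(1)[OF tq(3)] tq(1) by simp
    qed
    have step: "c (Suc p) = c p \<and> \<tau> p \<noteq> \<tau> (Suc p) \<or> c (Suc p) = Suc (c p) \<and> \<not> \<tau> p \<and> \<not> \<tau> (Suc p)"
      if p: "1 \<le> p" for p
    proof -
      obtain t q where tq: "p = 2 * n * t + q" "1 \<le> q" "q \<le> 2 * n"
        using path_decomp[OF p(1), of n] n by auto
      have cp: "c p = 2 * m * t + s q" unfolding tq(1) by (rule cq(1)[OF tq(2,3)])
      have \<tau>p: "\<tau> p = (q \<le> e \<and> even q)" unfolding tq(1) by (rule cq(2)[OF tq(2,3)])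
      show ?thesis
      proof (cases "q < 2 * n")
        case True
        have Sp: "Suc p = 2 * n * t + Suc q" using tq by simp
        have "c (Suc p) = 2 * m * t + s (Suc q)" "\<tau> (Suc p) = (Suc q \<le> e \<and> even (Suc q))"
          unfolding Sp using cq[of "Suc q" t] True by simp_all
        then show ?thesis using cp \<tau>p tq(2) e(2) by (cases "q = e") (auto simp: s_def)
      next
        case False
        then have q: "q = 2 * n" using tq by simp
        have Sp: "Suc p = 2 * n * (t + 1) + 1" using tq(1) q by simp
        have "c (Suc p) = 2 * m * (t + 1) + s 1" "\<tau> (Suc p) = (1 \<le> e \<and> even (1 :: nat))"
          unfolding Sp using cq[of 1 "t + 1"] n by simp_all
        then show ?thesis using cp \<tau>p q e(1) nm by (auto simp: s_def)
      qed
    qed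
    obtain v where v: "walk B 1 ?N ((x \<circ> path_index m) \<circ> c) v" "\<And>p. \<not> \<tau> p \<Longrightarrow> v p = w (c p)"
      using stretched_walk[where N = ?N and c = c and \<tau> = \<tau>, OF B w bound step] by auto
    have "v p \<in> root_den (side B (v p)) (g (x (path_index n p))) B" if p: "1 \<le> p" "p \<le> ?N" for p
    proof -
      obtain t q where tq: "p = 2 * n * t + q" "1 \<le> q" "q \<le> 2 * n"
        using path_decomp[OF p(1), of n] n by auto
      have "path_index m (c p) = s q" "path_index n p = q"
        using tq cq(1)[OF tq(2,3), of t] path_index_eq[of "s q" m t] s[OF tq(3)] path_index_eq[OF tq(2,3)] by simp_all
      then show ?thesis using walkD(1)[OF v(1) p] g[OF tq(2)] by (simp add: root_den_gen_letter[OF B])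
    qed
    then have "walk (subst_graph g B) 1 ?N (x \<circ> path_index n) v"
      using walkD(2)[OF v(1)] by (auto simp: walk_def)
    moreover have "v 1 = w 1" using v(2)[of 1] cq[of 1 0] n by (auto simp: s_def)
    ultimately show ?thesis by blast
  qed
  have \<phi>_den: "root_den d (\<phi> a) B = root_den d a (subst_graph g B)" if "cover B" for B :: "(nat \<times> bool, 'a) lgraph" and d a
    using root_den_endomorphism[OF \<phi>(1) that] \<phi>(2) by simp
  have idx: "path_index n 1 = 1" "path_index m 1 = 1" "path_index n 0 = 2 * n" "path_index m 0 = 2 * m"
    using path_index_eq[of 1 n 0] path_index_eq[of 1 m 0] n nm by (auto simp: path_index_def)
  have first: "mark B (h 1) (x 1)" if "cover B" "walk (subst_graph g B) a ?N (x \<circ> path_index n) h" "a \<le> 1"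
    for B :: "(nat \<times> bool, 'a) lgraph" and h a
    using walkD(1)[OF that(2,3)] N g[of 1] by (simp add: idx root_den_gen_letter[OF that(1)] s_def del: One_nat_def)
  have \<alpha>: "?T = dmeet d (\<phi> (alphad d x n k i)) ?T"
  proof (rule free_psl_root_pairs_eqI[of d], intro equalityI subsetI)
    fix B :: "(nat \<times> bool, 'a) lgraph" and z assume B: "cover B"
    note pairs = root_pairs_alpha_beta(1)[OF x nm(1) n(2) B] root_pairs_alpha_beta(1)[OF x n(1) kl(1) cover_subst_graph[OF B]]
    {
      assume "z \<in> root_pairs d ?T B"
      then obtain w where w: "z = (w 1, w 2)" "walk B 1 ?M (x \<circ> path_index m) w" "side B (w 1) = d"
        by (auto simp: pairs)
      obtain v where v: "walk (subst_graph g B) 1 ?N (x \<circ> path_index n) v" "v 1 = w 1"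
        using stretch[OF B w(2)] by blast
      have "w 1 \<in> root_den d (alphad d x n k i) (subst_graph g B)"
        unfolding root_den_root_pairs(1) pairs using v w(3)
        by (intro DomainI[of _ "v 2"] CollectI exI[of _ v]) simp
      moreover have "w 2 \<in> root_den (\<not> d) ?T B"
        unfolding root_den_root_pairs(2) pairs using w by auto
      moreover have "edge B (w 1) (w 2)" using walkD(2)[OF w(2), of 1] N by (simp add: numeral_2_eq_2)
      ultimately show "z \<in> root_pairs d (dmeet d (\<phi> (alphad d x n k i)) ?T) B"
        using w(1) by (simp add: root_pairs_dmeet[OF B] \<phi>_den[OF B])
    next
      assume "z \<in> root_pairs d (dmeet d (\<phi> (alphad d x n k i)) ?T) B"
      then obtain u v where z: "z = (u, v)" "edge B u v" "u \<in> root_den d (alphad d x n k i) (subst_graph g B)"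
        "v \<in> root_den (\<not> d) ?T B" by (auto simp: root_pairs_dmeet[OF B] \<phi>_den[OF B])
      obtain w where w: "v = w 2" "walk B 1 ?M (x \<circ> path_index m) w" "side B (w 1) = d"
        using z(4) unfolding root_den_root_pairs(2) pairs by auto
      obtain h where h: "u = h 1" "walk (subst_graph g B) 1 ?N (x \<circ> path_index n) h"
        using z(3) unfolding root_den_root_pairs(1) pairs by auto
      have "mark B u (x 1)" using first[OF B h(2)] h(1) by simp
      moreover have "mark B (w 1) (x 1)" using walkD(1)[OF w(2), of 1] N idx by simp
      moreover have "edge B (w 1) (w 2)" using walkD(2)[OF w(2), of 1] N by (simp add: numeral_2_eq_2)
      ultimately have "u = w 1"
        using coverD(3)[OF B, of "w 2" u "w 1"] coverD(1)[OF B] z(2) w(1) by blast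
      then show "z \<in> root_pairs d ?T B" using z(1) w by (auto simp: pairs)
    }
  qed
  have \<beta>: "betad d x m l j = dmeet d (\<phi> (betad d x n k i)) ?T"
  proof (rule free_psl_root_pairs_eqI[of d], intro equalityI subsetI)
    fix B :: "(nat \<times> bool, 'a) lgraph" and z assume B: "cover B"
    note pairs = root_pairs_alpha_beta[OF x nm(1) n(2) B] root_pairs_alpha_beta[OF x n(1) kl(1) cover_subst_graph[OF B]]
    {
      assume "z \<in> root_pairs d (betad d x m l j) B"
      then obtain w where w: "z = (w 1, w 2)" "walk B 0 ?M (x \<circ> path_index m) w" "side B (w 1) = d"
        by (auto simp: pairs)
      have w1: "walk B 1 ?M (x \<circ> path_index m) w" using w(2) by (auto simp: walk_def)
      obtain v where v: "walk (subst_graph g B) 1 ?N (x \<circ> path_index n) v" "v 1 = w 1"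
        using stretch[OF B w1] by blast
      define v' where "v' p = (if p = 0 then w 0 else v p)" for p
      have w0: "mark B (w 0) (x (2 * m))" "edge B (w 0) (w 1)"
        using walkD(1)[OF w(2), of 0] walkD(2)[OF w(2) le0 less_le_trans[OF zero_less_numeral N(2)]] idx by simp_all
      have "g (x (2 * n)) = gen_letter (x (2 * m))" using g[of "2 * n"] n e nm by (simp add: s_def)
      then have "mark (subst_graph g B) (w 0) (x (2 * n))"
        using w0 by (simp add: root_den_gen_letter[OF B])
      then have "walk (subst_graph g B) 0 ?N (x \<circ> path_index n) v'"
        unfolding walk_def using walkD[OF v(1)] v(2) w0(2) by (auto simp: v'_def idx)
      then have "w 1 \<in> root_den d (betad d x n k i) (subst_graph g B)"
        unfolding root_den_root_pairs(1) pairs using v w(3)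
        by (intro DomainI[of _ "v' 2"] CollectI exI[of _ v']) (simp add: v'_def)
      moreover have "w 2 \<in> root_den (\<not> d) ?T B"
        unfolding root_den_root_pairs(2) pairs using w1 w(3) by auto
      moreover have "edge B (w 1) (w 2)" using walkD(2)[OF w(2), of 1] N by (simp add: numeral_2_eq_2)
      ultimately show "z \<in> root_pairs d (dmeet d (\<phi> (betad d x n k i)) ?T) B"
        using w(1) by (simp add: root_pairs_dmeet[OF B] \<phi>_den[OF B])
    next
      assume "z \<in> root_pairs d (dmeet d (\<phi> (betad d x n k i)) ?T) B"
      then obtain u v where z: "z = (u, v)" "edge B u v" "u \<in> root_den d (betad d x n k i) (subst_graph g B)"
        "v \<in> root_den (\<not> d) ?T B" by (auto simp: root_pairs_dmeet[OF B] \<phi>_den[OF B])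
      obtain w where w: "v = w 2" "walk B 1 ?M (x \<circ> path_index m) w" "side B (w 1) = d"
        using z(4) unfolding root_den_root_pairs(2) pairs by auto
      obtain h where h: "u = h 1" "walk (subst_graph g B) 0 ?N (x \<circ> path_index n) h"
        using z(3) unfolding root_den_root_pairs(1) pairs by auto
      have "mark B u (x 1)" using first[OF B h(2)] h(1) by simp
      moreover have "mark B (w 1) (x 1)" using walkD(1)[OF w(2), of 1] N idx by simp
      moreover have "edge B (w 1) (w 2)" using walkD(2)[OF w(2), of 1] N by (simp add: numeral_2_eq_2)
      ultimately have u: "u = w 1"
        using coverD(3)[OF B, of "w 2" u "w 1"] coverD(1)[OF B] z(2) w(1) by blast
      have "g (x (2 * n)) = gen_letter (x (2 * m))" using g[of "2 * n"] n e nm by (simp add: s_def)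
      then have h0: "mark B (h 0) (x (2 * m))" "edge B (h 0) (h 1)"
        using walkD(1)[OF h(2), of 0] walkD(2)[OF h(2) le0 less_le_trans[OF zero_less_numeral N(1)]]
        by (simp_all add: idx root_den_gen_letter[OF B])
      define w' where "w' p = (if p = 0 then h 0 else w p)" for p
      have "walk B 0 ?M (x \<circ> path_index m) w'"
        unfolding walk_def using walkD[OF w(2)] h0 u h(1) by (auto simp: w'_def idx)
      then show "z \<in> root_pairs d (betad d x m l j) B"
        using z(1) w u by (auto simp: pairs w'_def intro!: exI[of _ w'])
    }
  qed
  have "(\<phi> (alphad d x n k i), \<phi> (betad d x n k i)) \<in> \<theta>"
    using \<theta>(2,3) \<phi>(1) unfolding fully_invariant_def by blast
  then have "(dmeet d (\<phi> (alphad d x n k i)) ?T, dmeet d (\<phi> (betad d x n k i)) ?T) \<in> \<theta>"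
    using congruence_dmeet[OF \<theta>(1) _ congruence_refl[OF \<theta>(1)]] by blast
  then show "(?T, betad d x m l j) \<in> \<theta>" using \<alpha> \<beta> by simp
qed

text \<open>Now the walk has to start at a neighbour of \<open>a'\<^sub>1\<close>, so the vertex that \<open>\<beta>\<close> adds is
  \<open>a'\<^sub>1\<close> itself; the letter \<open>x\<^sub>2\<^sub>n\<close> is therefore replaced by an edge carrying the label
  \<open>x\<^sub>2\<^sub>m\<close> at its other end.\<close>

lemma consequence_opposite_side:
  assumes x: "inj_on x {1..}" and nm: "2 \<le> m" "m \<le> n" and kl: "1 \<le> k" "k \<le> l"
    and ij: "1 \<le> i" "i \<le> 2 * n" "1 \<le> j" "l = k \<Longrightarrow> i + 2 * m < j + 2 * n"
  shows "(alphad (\<not> d) x m l j, betad (\<not> d) x m l j) is_consequence_of (alphad d x n k i, betad d x n k i)"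
proof (rule consequenceI)
  fix \<theta> assume \<theta>: "congruence \<theta>" "fully_invariant \<theta>" "(alphad d x n k i, betad d x n k i) \<in> \<theta>"
  let ?N = "2 * n * k + i" and ?M = "2 * m * l + j" and ?T = "alphad (\<not> d) x m l j"
  define e where "e = 2 * (n - m)"
  have e: "2 * n = e + 2 * m" "even e" using nm by (auto simp: e_def)
  define s where "s q = 1 + (q - e)" for q
  define G where "G q = (if q = 2 * n then dmeet d (gen_letter (x (2 * m))) (gen_letter (x 1)) else gen_letter (x (s q)))" for q
  obtain g where g: "\<And>q. 1 \<le> q \<Longrightarrow> g (x q) = G q"
    using substitution_on_letters[OF x, of G] by blast
  obtain \<phi> where \<phi>: "endomorphism \<phi>" "\<And>y. \<phi> (gen_letter y) = g y"
    using endomorphism_exists by blast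
  have n: "2 \<le> n" "1 \<le> l" using nm kl by auto
  have N: "2 \<le> ?N" "2 \<le> ?M"
    using mult_le_mono[of 2 n 1 k] mult_le_mono[of 2 m 1 l] n nm kl by linarith+
  have last: "v \<in> root_den (\<not> d) (G (2 * n)) B \<longleftrightarrow>
      side B v = (\<not> d) \<and> mark B v (x 1) \<and> (\<exists>u. edge B u v \<and> mark B u (x (2 * m)))"
    if B: "cover B" for B :: "(nat \<times> bool, 'a) lgraph" and v
    using coverD(2)[OF B, of _ v] by (auto simp: G_def root_den_dmeet(2)[OF B] root_den_gen_letter[OF B])
  define c where "c p = 2 * m * ((p - 1) div (2 * n)) + s (path_index n p)" for p
  define \<tau> where "\<tau> p = (path_index n p \<le> e \<and> odd (path_index n p))" for p
  have cq: "c (2 * n * t + q) = 2 * m * t + s q" "\<tau> (2 * n * t + q) = (q \<le> e \<and> odd q)"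
    if "1 \<le> q" "q \<le> 2 * n" for t q
    using that by (simp_all add: c_def \<tau>_def path_index_eq path_decomp_div del: One_nat_def)
  have s: "1 \<le> s q" "s q \<le> 2 * m + 1" if "q \<le> 2 * n" for q using that e nm by (auto simp: s_def)
  have stretch: "\<exists>v. walk (subst_graph g B) 1 ?N (x \<circ> path_index n) v \<and> edge B (v 1) (w 1)"
    if B: "cover B" and w: "walk B 1 ?M (x \<circ> path_index m) w" and sw: "side B (w 1) = (\<not> d)"
    for B :: "(nat \<times> bool, 'a) lgraph" and w
  proof -
    have bound: "1 \<le> c p \<and> c p \<le> ?M" if p: "1 \<le> p" "p \<le> ?N" for p
    proof -
      obtain t q where tq: "p = 2 * n * t + q" "1 \<le> q" "q \<le> 2 * n"
        using path_decomp[OF p(1), of n] n by auto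
      have "2 * n * t < 2 * n * (k + 1)" using p(2) tq ij by (simp add: algebra_simps)
      then have tk: "t \<le> k" by (simp only: mult_less_cancel1) simp
      have "2 * m * t + s q \<le> ?M"
      proof (cases "t < l")
        case True
        then have "2 * m * (t + 1) \<le> 2 * m * l" by (intro mult_le_mono) auto
        then show ?thesis using s(2)[OF tq(3)] ij(3) by simp
      next
        case False
        then have "t = k" "l = k" using tk kl by auto
        then show ?thesis using p(2) tq e ij(3) ij(4) by (auto simp: s_def)
      qed
      then show ?thesis using cq(1)[OF tq(2,3)] s(1)[OF tq(3)] tq(1) by simp
    qed
    have step: "c (Suc p) = c p \<and> \<tau> p \<noteq> \<tau> (Suc p) \<or> c (Suc p) = Suc (c p) \<and> \<not> \<tau> p \<and> \<not> \<tau> (Suc p)"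
      if p: "1 \<le> p" for p
    proof -
      obtain t q where tq: "p = 2 * n * t + q" "1 \<le> q" "q \<le> 2 * n"
        using path_decomp[OF p(1), of n] n by auto
      have cp: "c p = 2 * m * t + s q" unfolding tq(1) by (rule cq(1)[OF tq(2,3)])
      have \<tau>p: "\<tau> p = (q \<le> e \<and> odd q)" unfolding tq(1) by (rule cq(2)[OF tq(2,3)])
      show ?thesis
      proof (cases "q < 2 * n")
        case True
        have Sp: "Suc p = 2 * n * t + Suc q" using tq by simp
        have "c (Suc p) = 2 * m * t + s (Suc q)" "\<tau> (Suc p) = (Suc q \<le> e \<and> odd (Suc q))"
          unfolding Sp using cq[of "Suc q" t] True by simp_all
        then show ?thesis using cp \<tau>p tq(2) e(2) by (cases "q = e") (auto simp: s_def)
      next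
        case False
        then have q: "q = 2 * n" using tq by simp
        have Sp: "Suc p = 2 * n * (t + 1) + 1" using tq(1) q by simp
        have "c (Suc p) = 2 * m * (t + 1) + s 1" "\<tau> (Suc p) = (1 \<le> e \<and> odd (1 :: nat))"
          unfolding Sp using cq[of 1 "t + 1"] n by simp_all
        then show ?thesis using cp \<tau>p q e(1) nm by (auto simp: s_def)
      qed
    qed
    obtain v where v: "walk B 1 ?N ((x \<circ> path_index m) \<circ> c) v" "\<And>p. \<not> \<tau> p \<Longrightarrow> v p = w (c p)"
      "\<And>p. 1 \<le> p \<Longrightarrow> p \<le> ?N \<Longrightarrow> \<tau> p \<Longrightarrow> edge B (v p) (w (c p))"
      using stretched_walk[where N = ?N and c = c and \<tau> = \<tau>, OF B w bound step] by auto
    have v1: "edge B (v 1) (w 1)"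
    proof (cases "e = 0")
      case True
      then have "v 1 = w 2" using v(2)[of 1] cq[of 1 0] n by (auto simp: s_def numeral_2_eq_2)
      then show ?thesis using walkD(2)[OF w, of 1] N coverD(1)[OF B] by (simp add: numeral_2_eq_2)
    next
      case False
      then have "c 1 = 1" "\<tau> 1" using cq[of 1 0] n by (auto simp: s_def)
      then show ?thesis using v(3)[of 1] N by simp
    qed
    then have sv1: "side B (v 1) = d" using sw coverD(2)[OF B v1] by simp
    have "v p \<in> root_den (side B (v p)) (g (x (path_index n p))) B" if p: "1 \<le> p" "p \<le> ?N" for p
    proof -
      obtain t q where tq: "p = 2 * n * t + q" "1 \<le> q" "q \<le> 2 * n"
        using path_decomp[OF p(1), of n] n by auto
      have pq: "path_index n p = q" "c p = 2 * m * t + s q"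
        using tq cq(1)[OF tq(2,3), of t] path_index_eq[OF tq(2,3)] by simp_all
      have mk: "mark B (v p) (x (path_index m (c p)))" using walkD(1)[OF v(1) p] by simp
      show ?thesis
      proof (cases "q = 2 * n")
        case True
        then have sq: "c p = 2 * m * (t + 1) + 1" "\<not> \<tau> p" 
          using pq e tq cq(2)[OF tq(2,3), of t] nm by (auto simp: s_def)
        have vp: "v p = w (c p)" using v(2) sq(2) by blast
        have nb: "mark B (w (2 * m * (t + 1))) (x (2 * m))" "edge B (w (2 * m * (t + 1))) (w (c p))"
          using walkD[OF w, of "2 * m * (t + 1)"] bound[OF p] sq(1) nm by (auto simp: path_index_def)
        have ix: "path_index m (c p) = 1"
          using path_index_eq[of 1 m "t + 1"] sq(1) nm by simp
        have sd: "side B (v p) = (\<not> d)"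
          using walk_side[OF v(1) B p] tq True sv1 n by auto
        have "v p \<in> root_den (\<not> d) (G (2 * n)) B"
          unfolding last[OF B] using sd mk nb unfolding vp ix by blast
        then show ?thesis using g[OF tq(2)] pq(1) True sd by simp
      next
        case False
        then have "s q \<le> 2 * m" using tq e nm by (auto simp: s_def)
        then have "path_index m (c p) = s q" using path_index_eq[of "s q" m t] s[OF tq(3)] pq(2) by simp
        then show ?thesis using mk g[OF tq(2)] False pq(1) by (simp add: G_def root_den_gen_letter[OF B])
      qed
    qed
    then have "walk (subst_graph g B) 1 ?N (x \<circ> path_index n) v"
      using walkD(2)[OF v(1)] by (auto simp: walk_def)
    then show ?thesis using v1 by blast
  qed
  have \<phi>_den: "root_den d (\<phi> a) B = root_den d a (subst_graph g B)" if "cover B" for B :: "(nat \<times> bool, 'a) lgraph" and d a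
    using root_den_endomorphism[OF \<phi>(1) that] \<phi>(2) by simp
  have idx: "path_index m 1 = 1" "path_index m 2 = 2" "path_index n 0 = 2 * n" "path_index m 0 = 2 * m"
    using path_index_eq[of 1 m 0] path_index_eq[of 2 m 0] n nm by (auto simp: path_index_def)
  let ?C = "\<lambda>a. dmeet d (gen_letter (x 2)) (dmeet d a ?T)"
  have C: "root_pairs (\<not> d) (?C (\<phi> a)) B = {(v, u). edge B v u \<and> side B u = d \<and> mark B u (x 2) \<and>
      v \<in> root_den (\<not> d) ?T B \<and> (\<exists>z \<in> root_den d a (subst_graph g B). edge B z v)}"
    if B: "cover B" for B :: "(nat \<times> bool, 'a) lgraph" and a
    by (auto simp: root_pairs_dmeet(2)[OF B] root_den_dmeet(2)[OF B] root_den_gen_letter[OF B] \<phi>_den[OF B])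
  have second: "mark B (w 2) (x 2)" "edge B (w 1) (w 2)" "mark B (w 1) (x 1)"
    if "walk B a ?M (x \<circ> path_index m) w" "a \<le> 1" for B :: "(nat \<times> bool, 'a) lgraph" and a w
    using walkD(1)[OF that(1), of 1] walkD(1)[OF that(1), of 2] walkD(2)[OF that(1), of 1] that(2) N
    by (simp_all add: idx del: One_nat_def)
  have roots: "\<exists>w. z = (w 1, w 2) \<and> walk B 1 ?M (x \<circ> path_index m) w \<and> side B (w 1) = (\<not> d)"
    if B: "cover B" and z: "z \<in> root_pairs (\<not> d) (?C (\<phi> a)) B" for B :: "(nat \<times> bool, 'a) lgraph" and z a
  proof -
    obtain v u where z: "z = (v, u)" "edge B v u" "mark B u (x 2)" "v \<in> root_den (\<not> d) ?T B"
      using z by (auto simp: C[OF B])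
    obtain w where w: "v = w 1" "walk B 1 ?M (x \<circ> path_index m) w" "side B (w 1) = (\<not> d)"
      using z(4) unfolding root_den_root_pairs(1) root_pairs_alpha_beta(1)[OF x nm(1) n(2) B] by auto
    have "u = w 2" using coverD(3)[OF B z(2)] second[OF w(2)] z(3) w(1) by blast
    then show ?thesis using z w by blast
  qed
  have \<alpha>: "?T = ?C (\<phi> (alphad d x n k i))"
  proof (rule free_psl_root_pairs_eqI[of "\<not> d"], intro equalityI subsetI)
    fix B :: "(nat \<times> bool, 'a) lgraph" and z assume B: "cover B"
    note pairs = root_pairs_alpha_beta(1)[OF x nm(1) n(2) B] root_pairs_alpha_beta(1)[OF x n(1) kl(1) cover_subst_graph[OF B]]
    {
      assume "z \<in> root_pairs (\<not> d) ?T B"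
      then obtain w where w: "z = (w 1, w 2)" "walk B 1 ?M (x \<circ> path_index m) w" "side B (w 1) = (\<not> d)"
        by (auto simp: pairs)
      obtain v where v: "walk (subst_graph g B) 1 ?N (x \<circ> path_index n) v" "edge B (v 1) (w 1)"
        using stretch[OF B w(2,3)] by blast
      have "side B (v 1) = d" "side B (w 2) = d"
        using coverD(2)[OF B v(2)] coverD(2)[OF B second(2)[OF w(2)]] w(3) by simp_all
      then have "v 1 \<in> root_den d (alphad d x n k i) (subst_graph g B)"
        unfolding root_den_root_pairs(1) pairs using v
        by (intro DomainI[of _ "v 2"] CollectI exI[of _ v]) simp
      moreover have "w 1 \<in> root_den (\<not> d) ?T B"
        unfolding root_den_root_pairs(1) pairs using w by auto
      ultimately show "z \<in> root_pairs (\<not> d) (?C (\<phi> (alphad d x n k i))) B"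
        using w(1) v(2) second[OF w(2)] \<open>side B (w 2) = d\<close> by (auto simp: C[OF B])
    next
      assume "z \<in> root_pairs (\<not> d) (?C (\<phi> (alphad d x n k i))) B"
      from roots[OF B this] show "z \<in> root_pairs (\<not> d) ?T B" unfolding pairs by blast
    }
  qed
  have \<beta>: "betad (\<not> d) x m l j = ?C (\<phi> (betad d x n k i))"
  proof (rule free_psl_root_pairs_eqI[of "\<not> d"], intro equalityI subsetI)
    fix B :: "(nat \<times> bool, 'a) lgraph" and z assume B: "cover B"
    note pairs = root_pairs_alpha_beta[OF x nm(1) n(2) B] root_pairs_alpha_beta[OF x n(1) kl(1) cover_subst_graph[OF B]]
    {
      assume "z \<in> root_pairs (\<not> d) (betad (\<not> d) x m l j) B"
      then obtain w where w: "z = (w 1, w 2)" "walk B 0 ?M (x \<circ> path_index m) w" "side B (w 1) = (\<not> d)"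
        by (auto simp: pairs)
      have w1: "walk B 1 ?M (x \<circ> path_index m) w" using w(2) by (auto simp: walk_def)
      obtain v where v: "walk (subst_graph g B) 1 ?N (x \<circ> path_index n) v" "edge B (v 1) (w 1)"
        using stretch[OF B w1 w(3)] by blast
      have sides: "side B (v 1) = d" "side B (w 2) = d"
        using coverD(2)[OF B v(2)] coverD(2)[OF B second(2)[OF w1]] w(3) by simp_all
      define v' where "v' p = (if p = 0 then w 1 else v p)" for p
      have w0: "mark B (w 0) (x (2 * m))" "edge B (w 0) (w 1)"
        using walkD(1)[OF w(2), of 0] walkD(2)[OF w(2) le0 less_le_trans[OF zero_less_numeral N(2)]] idx by simp_all
      have "w 1 \<in> root_den (\<not> d) (G (2 * n)) B"
        unfolding last[OF B] using w0 w(3) second(3)[OF w1] by blast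
      then have "mark (subst_graph g B) (w 1) (x (2 * n))"
        using w(3) g[of "2 * n"] n by simp
      then have "walk (subst_graph g B) 0 ?N (x \<circ> path_index n) v'"
        unfolding walk_def using walkD[OF v(1)] coverD(1)[OF B v(2)] by (auto simp: v'_def idx)
      then have "v 1 \<in> root_den d (betad d x n k i) (subst_graph g B)"
        unfolding root_den_root_pairs(1) pairs using sides
        by (intro DomainI[of _ "v' 2"] CollectI exI[of _ v']) (simp add: v'_def)
      moreover have "w 1 \<in> root_den (\<not> d) ?T B"
        unfolding root_den_root_pairs(1) pairs using w1 w(3) by auto
      ultimately show "z \<in> root_pairs (\<not> d) (?C (\<phi> (betad d x n k i))) B"
        using w(1) v(2) second[OF w1] sides by (auto simp: C[OF B])
    next
      assume z: "z \<in> root_pairs (\<not> d) (?C (\<phi> (betad d x n k i))) B"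
      obtain w where w: "z = (w 1, w 2)" "walk B 1 ?M (x \<circ> path_index m) w" "side B (w 1) = (\<not> d)"
        using roots[OF B z] by blast
      obtain h where h: "edge B (h 1) (w 1)" "walk (subst_graph g B) 0 ?N (x \<circ> path_index n) h" "side B (h 1) = d"
        using z w(1) unfolding C[OF B] root_den_root_pairs(1) pairs by auto
      have h01: "edge B (h 0) (h 1)" using walkD(2)[OF h(2) le0 less_le_trans[OF zero_less_numeral N(1)]] by simp
      then have "side B (h 0) = (\<not> d)" using coverD(2)[OF B] h(3) by blast
      moreover have "h 0 \<in> root_den (side B (h 0)) (G (2 * n)) B"
        using walkD(1)[OF h(2), of 0] g[of "2 * n"] n by (simp add: idx)
      ultimately obtain u where u: "mark B (h 0) (x 1)" "edge B u (h 0)" "mark B u (x (2 * m))"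
        using last[OF B, of "h 0"] by auto
      have "h 0 = w 1"
        using coverD(3)[OF B coverD(1)[OF B h01] h(1) u(1) second(3)[OF w(2)]] by simp
      define w' where "w' p = (if p = 0 then u else w p)" for p
      have "walk B 0 ?M (x \<circ> path_index m) w'"
        unfolding walk_def using walkD[OF w(2)] u \<open>h 0 = w 1\<close> by (auto simp: w'_def idx)
      then show "z \<in> root_pairs (\<not> d) (betad (\<not> d) x m l j) B"
        using w by (auto simp: pairs w'_def intro!: exI[of _ w'])
    }
  qed
  have "(\<phi> (alphad d x n k i), \<phi> (betad d x n k i)) \<in> \<theta>"
    using \<theta>(2,3) \<phi>(1) unfolding fully_invariant_def by blast
  then have "(?C (\<phi> (alphad d x n k i)), ?C (\<phi> (betad d x n k i))) \<in> \<theta>"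
    using congruence_dmeet[OF \<theta>(1) congruence_refl[OF \<theta>(1)] congruence_dmeet[OF \<theta>(1) _ congruence_refl[OF \<theta>(1)]]] by blast
  then show "(?T, betad (\<not> d) x m l j) \<in> \<theta>" using \<alpha> \<beta> by simp
qed

section \<open>Independence of the identities\<close>

text \<open>A closed walk in a tree backtracks at a vertex of maximal rank; removing backtracks shows that
  its sequence of labels describes a closed walk in every cover.\<close>

lemma closed_walk_transfer:
  fixes rk :: "'u \<Rightarrow> nat"
  assumes B': "cover B'" and B: "cover B"
    and rk: "\<And>u v. edge B' u v \<Longrightarrow> rk u \<noteq> rk v"
      "\<And>u v w. edge B' w u \<Longrightarrow> edge B' w v \<Longrightarrow> rk u < rk w \<Longrightarrow> rk v < rk w \<Longrightarrow> u = v"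
    and single: "\<And>v y z. mark B' v y \<Longrightarrow> mark B' v z \<Longrightarrow> y = z"
  shows "walk B' 0 N y v \<Longrightarrow> walk B 0 N y w \<Longrightarrow> v 0 = v N \<Longrightarrow> w 0 = w N"
proof (induction N arbitrary: y v w rule: less_induct)
  case (less N)
  note v = walkD[OF less.prems(1)] and w = walkD[OF less.prems(2)]
  have sym: "edge B' a b \<Longrightarrow> edge B' b a" "edge B p q \<Longrightarrow> edge B q p" for a b p q
    using coverD(1)[OF B'] coverD(1)[OF B] by blast+
  consider "N = 0" | "N = 1" | "2 \<le> N" by linarith
  then show ?case
  proof cases
    case 2
    then show ?thesis using v(2)[of 0] rk(1)[of "v 0" "v 0"] less.prems(3) by simp
  next
    case 3
    have "Max ((rk \<circ> v) ` {0..N}) \<in> (rk \<circ> v) ` {0..N}" by (intro Max_in) auto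
    then obtain p where "Max ((rk \<circ> v) ` {0..N}) = (rk \<circ> v) p" "p \<in> {0..N}" by (rule imageE)
    then have p: "p \<le> N" "rk (v p) = Max ((rk \<circ> v) ` {0..N})" by simp_all
    have max: "rk (v q) \<le> rk (v p)" if "q \<le> N" for q
      unfolding p(2) using that by (intro Max_ge) auto
    show ?thesis
    proof (cases "0 < p \<and> p < N")
      case True
      then obtain r where r: "p = Suc r" by (cases p) auto
      have e: "edge B' (v p) (v r)" "edge B' (v p) (v (Suc p))" "edge B (w p) (w r)" "edge B (w p) (w (Suc p))"
        using v(2)[of r] v(2)[of p] w(2)[of r] w(2)[of p] sym r True by auto
      then have "rk (v r) < rk (v p)" "rk (v (Suc p)) < rk (v p)"
        using max[of r] max[of "Suc p"] rk(1)[OF e(1)] rk(1)[OF e(2)] r True by auto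
      then have vv: "v r = v (Suc p)" using rk(2) e by blast
      then have "y r = y (Suc p)" using v(1)[of r] v(1)[of "Suc p"] single r True by auto
      then have ww: "w r = w (Suc p)"
        using coverD(3)[OF B e(3,4) w(1)[of r]] w(1)[of "Suc p"] r True by auto
      define f where "f q = (if q < p then q else q + 2)" for q
      have walks: "walk B' 0 (N - 2) (y \<circ> f) (v \<circ> f)" "walk B 0 (N - 2) (y \<circ> f) (w \<circ> f)"
      proof -
        have f1: "f q \<le> N" if "q \<le> N - 2" for q using that 3 by (auto simp: f_def)
        have f2: "f q < N \<and> f (Suc q) = Suc (f q) \<or> f q = r \<and> f (Suc q) = Suc (Suc p) \<and> Suc p < N"
          if "q < N - 2" for q using that True r by (auto simp: f_def)
        show "walk B' 0 (N - 2) (y \<circ> f) (v \<circ> f)"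
          unfolding walk_def comp_def using f1 f2 v vv by (metis atLeastAtMost_iff atLeastLessThan_iff le0)
        show "walk B 0 (N - 2) (y \<circ> f) (w \<circ> f)"
          unfolding walk_def comp_def using f1 f2 w ww by (metis atLeastAtMost_iff atLeastLessThan_iff le0)
      qed
      have ends: "f 0 = 0" "f (N - 2) = N \<or> f (N - 2) = r \<and> Suc p = N"
        using True 3 r by (auto simp: f_def)
      have vN: "v (f (N - 2)) = v N" and wN: "w (f (N - 2)) = w N" using ends(2) vv ww by metis+
      have "(w \<circ> f) 0 = (w \<circ> f) (N - 2)"
        by (rule less.IH[OF _ walks]) (use 3 ends(1) vN less.prems(3) in simp_all)
      then show ?thesis using ends(1) wN by simp
    next
      case False
      then have "v p = v 0" using p(1) less.prems(3) by (cases "p = 0") auto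
      obtain r where r: "N = Suc r" "1 \<le> r" using 3 by (cases N) auto
      have e: "edge B' (v 0) (v 1)" "edge B' (v 0) (v r)" "edge B (w 0) (w 1)" "edge B (w N) (w r)"
        using v(2)[of 0] v(2)[of r] w(2)[of 0] w(2)[of r] sym r less.prems(3) by auto
      have "rk (v 1) < rk (v 0)" "rk (v r) < rk (v 0)"
        using max[of 1] max[of r] rk(1)[OF e(1)] rk(1)[OF e(2)] r \<open>v p = v 0\<close> by auto
      then have "v 1 = v r" using rk(2) e by blast
      moreover have walks: "walk B' 0 (N - 2) (y \<circ> Suc) (v \<circ> Suc)" "walk B 0 (N - 2) (y \<circ> Suc) (w \<circ> Suc)"
        using v w 3 by (auto simp: walk_def)
      moreover have "Suc (N - 2) = r" using r by simp
      ultimately have "(w \<circ> Suc) 0 = (w \<circ> Suc) (N - 2)"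
        by (intro less.IH[OF _ walks]) (use 3 in simp_all)
      then have "w 1 = w r" using \<open>Suc (N - 2) = r\<close> by simp
      moreover have "y 0 = y N" using v(1)[of 0] v(1)[of N] single less.prems(3) by auto
      ultimately show ?thesis
        using coverD(3)[OF B, of "w 1" "w 0" "w N" "y 0"] sym(2)[OF e(3)] sym(2)[OF e(4)] w(1)[of 0] w(1)[of N] by auto
    qed
  qed simp
qed

lemma lipschitz_walk:
  fixes C :: "nat \<Rightarrow> int"
  assumes "\<And>p. 1 \<le> p \<Longrightarrow> p < N \<Longrightarrow> \<bar>C (Suc p) - C p\<bar> \<le> 1" "1 \<le> p" "p \<le> q" "q \<le> N"
  shows "\<bar>C q - C p\<bar> \<le> int q - int p"
  using assms(3,4)
proof (induction q rule: dec_induct)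
  case (step q)
  then show ?case using assms(1)[of q] assms(2) by linarith
qed simp

lemma translate_walk:
  fixes C :: "nat \<Rightarrow> int"
  assumes "\<And>p. 1 \<le> p \<Longrightarrow> p + P \<le> N \<Longrightarrow> C (p + P) = C p + D" "1 \<le> p" "p + P * r \<le> N"
  shows "C (p + P * r) = C p + D * int r"
  using assms(3)
proof (induction r)
  case (Suc r)
  have "C (p + P * r + P) = C (p + P * r) + D" using Suc.prems assms(1)[of "p + P * r"] assms(2) by simp
  then show ?case using Suc by (simp add: algebra_simps)
qed simp

lemma ascending_walk:
  fixes C :: "nat \<Rightarrow> int"
  assumes step: "\<And>p. 1 \<le> p \<Longrightarrow> p < N \<Longrightarrow> \<bar>C (Suc p) - C p\<bar> \<le> 1"
    and N: "N = 2 * n * k + i" "1 \<le> i" "i \<le> 2 * n" "1 \<le> k"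
    and range: "\<And>p. 1 \<le> p \<Longrightarrow> p \<le> N \<Longrightarrow> 1 \<le> C p \<and> C p \<le> 2 * int m * int k + int j"
    and shift: "\<And>p. 1 \<le> p \<Longrightarrow> p + 2 * n \<le> N \<Longrightarrow> C (p + 2 * n) = C p + 2 * int m"
  shows "i + 2 * m \<le> j + 2 * n"
    and "i + 2 * m = j + 2 * n \<Longrightarrow> C 1 = 1 \<and> C (2 * n + 1) = C (2 * n) + 1"
proof -
  have "2 * n * 1 \<le> 2 * n * k" using N(4) by (rule mult_le_mono2)
  then have N': "2 * n + 1 \<le> N" using N(1,2) by linarith
  have "C (i + 2 * n * k) = C i + 2 * int m * int k"
    using translate_walk[of "2 * n" N C "2 * int m" i k] shift N by simp
  then have Ci: "C i \<le> int j" using range[of "i + 2 * n * k"] N by simp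
  have s: "C (1 + 2 * n) = C 1 + 2 * int m" using shift[of 1] N' by simp
  have "\<bar>C (2 * n) - C i\<bar> \<le> int (2 * n) - int i"
    by (rule lipschitz_walk[of N]) (use step N(2,3) N' in auto)
  moreover have "\<bar>C (Suc (2 * n)) - C (2 * n)\<bar> \<le> 1" by (rule step) (use N(2,3) N' in auto)
  ultimately have up: "C (2 * n) - C i \<le> 2 * int n - int i" "C (2 * n + 1) - C (2 * n) \<le> 1"
    by auto
  have "1 \<le> C 1" using range[of 1] N' by simp
  then show "i + 2 * m \<le> j + 2 * n"
    "i + 2 * m = j + 2 * n \<Longrightarrow> C 1 = 1 \<and> C (2 * n + 1) = C (2 * n) + 1"
    using Ci s up by (simp_all add: add.commute)
qed

text \<open>The displacement over one period is a multiple of \<open>2m \<ge> 4\<close> and changes by at most \<open>2\<close> from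
  one vertex to the next, so it is constant.\<close>

lemma periodic_walk:
  fixes C :: "nat \<Rightarrow> int"
  assumes m: "2 \<le> m"
    and step: "\<And>p. 1 \<le> p \<Longrightarrow> p < N \<Longrightarrow> \<bar>C (Suc p) - C p\<bar> \<le> 1"
    and N: "N = 2 * n * k + i" "1 \<le> i" "i \<le> 2 * n" "1 \<le> k" and j: "j \<le> 2 * m"
    and range: "\<And>p. 1 \<le> p \<Longrightarrow> p \<le> N \<Longrightarrow> 1 \<le> C p \<and> C p \<le> 2 * int m * int l + int j"
    and period: "\<And>p. 1 \<le> p \<Longrightarrow> p + 2 * n \<le> N \<Longrightarrow> 2 * int m dvd C (p + 2 * n) - C p"
    and ne: "C (2 * n + 1) \<noteq> C 1"
  shows "m \<le> n" "k \<le> l" "l = k \<Longrightarrow> i + 2 * m \<le> j + 2 * n"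
    "l = k \<Longrightarrow> i + 2 * m = j + 2 * n \<Longrightarrow>
      (C 1 = 1 \<or> C 1 = 2 * int m * int k + int j) \<and> C (2 * n + 1) \<noteq> C (2 * n) \<and> even (C (2 * n + 1) - C 1)"
proof -
  have "2 * n * 1 \<le> 2 * n * k" using N(4) by (rule mult_le_mono2)
  then have N': "2 * n + 1 \<le> N" using N(1,2) by linarith
  define \<delta> where "\<delta> p = C (p + 2 * n) - C p" for p
  have const: "\<delta> p = \<delta> 1" if "1 \<le> p" "p + 2 * n \<le> N" for p
    using that
  proof (induction p rule: dec_induct)
    case (step p)
    have "\<bar>\<delta> (Suc p) - \<delta> p\<bar> \<le> 2"
      using assms(2)[of p] assms(2)[of "p + 2 * n"] step by (simp add: \<delta>_def)
    moreover have "2 * int m dvd \<delta> (Suc p) - \<delta> p"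
      using period[of p] period[of "Suc p"] step by (auto simp: \<delta>_def intro: dvd_diff)
    ultimately have "\<delta> (Suc p) - \<delta> p = 0"
      using m dvd_imp_le_int[of "\<delta> (Suc p) - \<delta> p" "2 * int m"] by linarith
    then show ?case using step by simp
  qed simp
  have shift: "C (p + 2 * n) = C p + \<delta> 1" if "1 \<le> p" "p + 2 * n \<le> N" for p
    using const[OF that] by (simp add: \<delta>_def)
  obtain t where t: "\<delta> 1 = 2 * int m * t" using period[of 1] N' by (auto simp: \<delta>_def dvd_def)
  have "t \<noteq> 0" using ne t by (auto simp: \<delta>_def add.commute)
  then have "2 * int m * 1 \<le> 2 * int m * \<bar>t\<bar>" by (intro mult_left_mono) auto
  then have "2 * int m \<le> \<bar>\<delta> 1\<bar>" using t by (simp add: abs_mult)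
  moreover have "\<bar>\<delta> 1\<bar> \<le> 2 * int n"
    using lipschitz_walk[of N C 1 "1 + 2 * n"] step N' by (simp add: \<delta>_def)
  ultimately show "m \<le> n" by simp
  have "C (1 + 2 * n * k) = C 1 + \<delta> 1 * int k"
    using translate_walk[of "2 * n" N C "\<delta> 1" 1 k] shift N by simp
  moreover have "1 \<le> C 1" "C 1 \<le> 2 * int m * int l + int j"
    "1 \<le> C (1 + 2 * n * k)" "C (1 + 2 * n * k) \<le> 2 * int m * int l + int j"
    using range[of 1] range[of "1 + 2 * n * k"] N by auto
  moreover have "int j \<le> 2 * int m" using j by simp
  ultimately have "\<bar>\<delta> 1 * int k\<bar> < 2 * int m * int l + 2 * int m" by linarith
  then have "2 * int m * (\<bar>t\<bar> * int k) < 2 * int m * (int l + 1)"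
    using t by (simp add: abs_mult algebra_simps)
  then have tk: "\<bar>t\<bar> * int k \<le> int l" using m by simp
  moreover have "1 * int k \<le> \<bar>t\<bar> * int k" using \<open>t \<noteq> 0\<close> by (intro mult_right_mono) auto
  ultimately show "k \<le> l" by simp
  have ev: "even (C (2 * n + 1) - C 1)" using t by (simp add: \<delta>_def add.commute)
  have "i + 2 * m \<le> j + 2 * n \<and> (i + 2 * m = j + 2 * n \<longrightarrow>
      (C 1 = 1 \<or> C 1 = 2 * int m * int k + int j) \<and> C (2 * n + 1) \<noteq> C (2 * n))" if lk: "l = k"
  proof -
    have "\<bar>t\<bar> * int k \<le> 1 * int k" using tk lk by simp
    then have "\<bar>t\<bar> \<le> 1" using N(4) mult_le_cancel_right_pos[of "int k" "\<bar>t\<bar>" 1] by simp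
    have range': "1 \<le> C p \<and> C p \<le> 2 * int m * int k + int j" if "1 \<le> p" "p \<le> N" for p
      using range[OF that] lk by simp
    from \<open>\<bar>t\<bar> \<le> 1\<close> consider "t = 1" | "t = -1" using \<open>t \<noteq> 0\<close> by linarith
    then show ?thesis
    proof cases
      case 1
      have "C (p + 2 * n) = C p + 2 * int m" if "1 \<le> p" "p + 2 * n \<le> N" for p
        using shift[OF that] t 1 by simp
      from ascending_walk[where m = m and j = j, OF step N range' this] show ?thesis by auto
    next
      case 2
      define C' where "C' p = 2 * int m * int k + int j + 1 - C p" for p
      have "C' (p + 2 * n) = C' p + 2 * int m" if "1 \<le> p" "p + 2 * n \<le> N" for p
        using shift[OF that] t 2 by (simp add: C'_def)
      moreover have "\<bar>C' (Suc p) - C' p\<bar> \<le> 1" if "1 \<le> p" "p < N" for p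
        using step[OF that] by (simp add: C'_def)
      moreover have "1 \<le> C' p \<and> C' p \<le> 2 * int m * int k + int j" if "1 \<le> p" "p \<le> N" for p
        using range'[OF that] by (simp add: C'_def)
      ultimately have "i + 2 * m \<le> j + 2 * n" "i + 2 * m = j + 2 * n \<Longrightarrow> C' 1 = 1 \<and> C' (2 * n + 1) = C' (2 * n) + 1"
        using ascending_walk[of N C' n k i m j] N by blast+
      then show ?thesis by (auto simp: C'_def)
    qed
  qed
  then show "l = k \<Longrightarrow> i + 2 * m \<le> j + 2 * n" "l = k \<Longrightarrow> i + 2 * m = j + 2 * n \<Longrightarrow>
      (C 1 = 1 \<or> C 1 = 2 * int m * int k + int j) \<and> C (2 * n + 1) \<noteq> C (2 * n) \<and> even (C (2 * n + 1) - C 1)"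
    using ev by blast+
qed

lemma root_pairs_endomorphism:
  assumes "endomorphism \<phi>" "cover B"
  shows "root_pairs d (\<phi> a) B = root_pairs d a (subst_graph (\<lambda>y. \<phi> (gen_letter y)) B)"
  using root_den_endomorphism[OF assms]
  by (simp add: root_pairs_root_den[OF assms(2)] root_pairs_root_den[OF cover_subst_graph[OF assms(2)]])

lemma walk_subst_graph:
  assumes h: "walk (subst_graph g B) 1 N z h" "side B (h 1) = d" and B: "cover B"
  shows "walk B 1 N (\<lambda>p. root_label (d = odd p) (g (z p))) h"
  unfolding walk_def
proof (intro conjI ballI)
  fix p assume p: "p \<in> {1..N}"
  have "side B (h p) = (d = odd p)"
    using walk_side[OF h(1) cover_subst_graph[OF B], of p] p h(2) by auto
  then have "h p \<in> root_den (d = odd p) (g (z p)) B" using walkD(1)[OF h(1), of p] p by auto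
  from root_denD(2)[OF this B] show "mark B (h p) (root_label (d = odd p) (g (z p)))" .
qed (use walkD(2)[OF h(1)] in auto)

text \<open>The largest fully invariant congruence contained in the Rees congruence of the ideal of all
  elements with empty denotation in \<open>B\<close>.\<close>

definition image_null :: "('v, 'a) lgraph \<Rightarrow> ('a free_psl \<times> 'a free_psl) set" where
  "image_null B = {(a, b). \<forall>\<phi>. endomorphism \<phi> \<longrightarrow> \<phi> a = \<phi> b \<or> den (\<phi> a) B = {} \<and> den (\<phi> b) B = {}}"

lemma image_null_congruence:
  fixes B :: "('v, 'a) lgraph"
  assumes "cover B"
  shows "congruence (image_null B)" "fully_invariant (image_null B)"
proof -
  have "(meet a c, meet b e) \<in> image_null B" if "(a, b) \<in> image_null B" "(c, e) \<in> image_null B" for a b c e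
    unfolding image_null_def
  proof (clarify)
    fix \<phi> assume \<phi>: "endomorphism \<phi>" and ne: "\<not> (den (\<phi> (meet a c)) B = {} \<and> den (\<phi> (meet b e)) B = {})"
    have hom: "\<phi> (meet p q) = meet (\<phi> p) (\<phi> q)" for p q using \<phi> by (simp add: endomorphism_def)
    have "\<phi> a = \<phi> b \<or> den (\<phi> a) B = {} \<and> den (\<phi> b) B = {}"
      "\<phi> c = \<phi> e \<or> den (\<phi> c) B = {} \<and> den (\<phi> e) B = {}"
      using that \<phi> by (auto simp: image_null_def)
    then show "\<phi> (meet a c) = \<phi> (meet b e)" using ne by (auto simp: hom den_meet[OF assms])
  qed
  moreover have "refl (image_null B)" "sym (image_null B)" by (auto simp: image_null_def refl_on_def sym_def)
  moreover have "trans (image_null B)" unfolding trans_def image_null_def by clarify metis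
  ultimately show "congruence (image_null B)" by (simp add: congruence_def equiv_def)
  show "fully_invariant (image_null B)"
    unfolding fully_invariant_def
  proof (intro allI impI)
    fix \<phi> :: "'a free_psl \<Rightarrow> 'a free_psl" and a b
    assume \<phi>: "endomorphism \<phi>" and ab: "(a, b) \<in> image_null B"
    show "(\<phi> a, \<phi> b) \<in> image_null B"
      unfolding image_null_def
    proof clarify
      fix \<psi> assume \<psi>: "endomorphism \<psi>" "\<not> (den (\<psi> (\<phi> a)) B = {} \<and> den (\<psi> (\<phi> b)) B = {})"
      then have "endomorphism (\<psi> \<circ> \<phi>)" using \<phi> by (simp add: endomorphism_def)
      then have "(\<psi> \<circ> \<phi>) a = (\<psi> \<circ> \<phi>) b \<or> den ((\<psi> \<circ> \<phi>) a) B = {} \<and> den ((\<psi> \<circ> \<phi>) b) B = {}"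
        using ab unfolding image_null_def by blast
      then show "\<psi> (\<phi> a) = \<psi> (\<phi> b)" using \<psi>(2) by simp
    qed
  qed
qed

lemma path_index_add: "path_index n (p + 2 * n) = path_index n p"
  by (simp add: path_index_def)

lemma path_index_cong: "path_index m p = path_index m q \<Longrightarrow> 2 * int m dvd int p - int q"
proof -
  assume "path_index m p = path_index m q"
  moreover have "path_index m r mod (2 * m) = r mod (2 * m)" for r by (auto simp: path_index_def)
  ultimately have "p mod (2 * m) = q mod (2 * m)" by metis
  then have "int p mod (2 * int m) = int q mod (2 * int m)"
    by (metis of_nat_mod of_nat_mult of_nat_numeral)
  then show ?thesis by (simp add: mod_eq_dvd_iff)
qed

lemma alpha_neq_beta:
  assumes x: "inj_on x {1..}" "n \<ge> 2" "k \<ge> 1"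
  shows "alphad d x n k i \<noteq> betad d x n k i"
proof
  note r = alpha_beta_reduced[OF x, of i] and b = alpha_beta_bitree[OF x(2,3), of x i]
  assume "alphad d x n k i = betad d x n k i"
  then have "tree_iso (alpha_tree x n k i) (beta_tree x n k i) \<or>
      tree_iso (swap_roots (alpha_tree x n k i)) (swap_roots (beta_tree x n k i))"
    using abs_free_psl_eq_iff[OF b(1) r(1) b(2) r(2)]
      abs_free_psl_eq_iff[OF swap_roots_bitree[OF b(1)] swap_roots_reduced[OF r(1)]
        swap_roots_bitree[OF b(2)] swap_roots_reduced[OF r(2)]]
    by (cases d) (auto simp: alphad_def betad_def alpha_def beta_def alpha_star_def beta_star_def)
  then obtain f where "bij_betw f (verts (alpha_tree x n k i)) (verts (beta_tree x n k i))"
    by (auto simp: tree_iso_def swap_roots_def)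
  then have "card {1..2 * n * k + i} = card {0..2 * n * k + i}"
    by (auto simp: alpha_tree_def beta_tree_eq[OF x(2,3)] Let_def dest: bij_betw_same_card)
  then show False by simp
qed

lemma not_consequence:
  assumes x: "inj_on x {1..}" and nm: "2 \<le> n" "2 \<le> m" and kl: "1 \<le> k" "1 \<le> l"
    and i: "1 \<le> i" "i \<le> 2 * n" and j: "1 \<le> j" "j \<le> 2 * m"
    and fails: "m \<le> n \<Longrightarrow> l \<le> k" "m \<le> n \<Longrightarrow> l = k \<Longrightarrow> j + 2 * n \<le> i + 2 * m"
      "m \<le> n \<Longrightarrow> l = k \<Longrightarrow> j + 2 * n = i + 2 * m \<Longrightarrow> d' \<noteq> d \<and> odd j"
  shows "\<not> (alphad d' x m l j, betad d' x m l j) is_consequence_of (alphad d x n k i, betad d x n k i)"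
proof
  let ?N = "2 * n * k + i" and ?M = "2 * m * l + j"
  let ?T = "alpha_tree x m l j"
  define B' where "B' = thorned ?T (\<lambda>p. d' = odd p)"
  have B': "cover B'"
    unfolding B'_def
    by (rule cover_thorned[OF alpha_beta_bitree(1)[OF nm(2) kl(2)] alpha_beta_reduced(1)[OF x nm(2) kl(2)]])
      (auto simp: alpha_tree_def Let_def)
  have edge': "edge B' (p, s) (q, t) \<Longrightarrow> p = q \<and> s \<noteq> t \<or> \<not> s \<and> \<not> t \<and> (q = Suc p \<or> p = Suc q)" for p q s t
    by (auto simp: B'_def thorned_def alpha_tree_def Let_def)
  have mark': "mark B' (p, s) y \<Longrightarrow> 1 \<le> p \<and> p \<le> ?M \<and> y = x (path_index m p)" for p s y
    by (auto simp: B'_def thorned_def alpha_tree_def Let_def path_index_def)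
  have side': "side B' v = ((d' = odd (fst v)) \<noteq> snd v)" for v
    by (cases v) (simp add: B'_def thorned_def)
  define rk where "rk v = 2 * fst v + of_bool (snd v)" for v :: "nat \<times> bool"
  have rk: "rk u \<noteq> rk v" if "edge B' u v" for u v
    using edge'[of "fst u" "snd u" "fst v" "snd v"] that
    by (auto simp: rk_def) presburger+
  have rk': "u = v" if "edge B' w u" "edge B' w v" "rk u < rk w" "rk v < rk w" for u v w
    using edge'[of "fst w" "snd w" "fst u" "snd u"] edge'[of "fst w" "snd w" "fst v" "snd v"] that
    by (auto simp: rk_def prod_eq_iff split: if_splits)
  have N: "2 * n + 1 \<le> ?N" using mult_le_mono2[OF kl(1), of "2 * n"] i by linarith

  have closed: "h (2 * n + 1) = h 1"
    if h: "walk (subst_graph g B') 1 ?N (x \<circ> path_index n) h" "side B' (h 1) = d" for g h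
  proof -
    define y where "y p = root_label (d = odd p) (g ((x \<circ> path_index n) p))" for p
    have wy: "walk B' 1 ?N y h"
      using walk_subst_graph[OF h B'] unfolding y_def .
    have side_h: "side B' (h p) = (d = odd p)" if "1 \<le> p" "p \<le> ?N" for p
      using walk_side[OF wy B' that] h(2) that by auto
    define C where "C p = int (fst (h p))" for p
    have step: "\<bar>C (Suc p) - C p\<bar> \<le> 1" if "1 \<le> p" "p < ?N" for p
      using walkD(2)[OF wy that] edge'[of "fst (h p)" "snd (h p)" "fst (h (Suc p))" "snd (h (Suc p))"]
      by (auto simp: C_def)
    have pos: "1 \<le> fst (h p) \<and> fst (h p) \<le> ?M \<and> y p = x (path_index m (fst (h p)))" if "1 \<le> p" "p \<le> ?N" for p
      using walkD(1)[OF wy that] mark'[of "fst (h p)" "snd (h p)"] by simp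
    have range: "1 \<le> C p \<and> C p \<le> 2 * int m * int l + int j" if "1 \<le> p" "p \<le> ?N" for p
    proof -
      have "int 1 \<le> C p" "C p \<le> int ?M" using pos[OF that] unfolding C_def of_nat_le_iff by simp_all
      then show ?thesis by simp
    qed
    have period: "2 * int m dvd C (p + 2 * n) - C p" if "1 \<le> p" "p + 2 * n \<le> ?N" for p
    proof -
      have "y (p + 2 * n) = y p" by (simp add: y_def path_index_add)
      then have "x (path_index m (fst (h (p + 2 * n)))) = x (path_index m (fst (h p)))"
        using pos[of p] pos[of "p + 2 * n"] that by simp
      moreover have "path_index m r \<in> {1..}" for r using path_index_range[of m r] nm by simp
      ultimately have "path_index m (fst (h (p + 2 * n))) = path_index m (fst (h p))"
        using inj_onD[OF x] by blast
      then show ?thesis unfolding C_def by (rule path_index_cong)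
    qed
    have "C (2 * n + 1) = C 1"
    proof (rule ccontr)
      assume ne: "C (2 * n + 1) \<noteq> C 1"
      have "m \<le> n" "k \<le> l"
        by (rule periodic_walk(1)[of m ?N C n k i j l] periodic_walk(2)[of m ?N C n k i j l];
          fact nm(2) step refl i kl(1) j(2) range period ne)+
      then have lk: "l = k" using fails(1) by simp
      have "i + 2 * m \<le> j + 2 * n"
        by (rule periodic_walk(3)[of m ?N C n k i j l]; fact nm(2) step refl i kl(1) j(2) range period ne lk)
      then have eq: "i + 2 * m = j + 2 * n" using fails(2) \<open>m \<le> n\<close> lk by simp
      then have d: "d' \<noteq> d" "odd j" using fails(3) \<open>m \<le> n\<close> lk by auto
      have Q: "(C 1 = 1 \<or> C 1 = 2 * int m * int k + int j) \<and> C (2 * n + 1) \<noteq> C (2 * n) \<and> even (C (2 * n + 1) - C 1)"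
        by (rule periodic_walk(4)[of m ?N C n k i j l]; fact nm(2) step refl i kl(1) j(2) range period ne lk eq)
      have "odd (C 1)" using Q d(2) by auto
      then have "odd (fst (h 1))" "odd (fst (h (2 * n + 1)))" using Q by (auto simp: C_def)
      then have "snd (h (2 * n + 1))"
        using side_h[of "2 * n + 1"] side'[of "h (2 * n + 1)"] N d(1) by auto
      moreover have "edge B' (h (2 * n)) (h (2 * n + 1))" using walkD(2)[OF wy, of "2 * n"] N nm by simp
      ultimately have "fst (h (2 * n + 1)) = fst (h (2 * n))"
        using edge'[of "fst (h (2 * n))" "snd (h (2 * n))" "fst (h (2 * n + 1))" "snd (h (2 * n + 1))"]
        unfolding prod.collapse by metis
      then show False using Q by (simp add: C_def)
    qed
    then have "fst (h (2 * n + 1)) = fst (h 1)" by (simp add: C_def)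
    moreover from this have "snd (h (2 * n + 1)) = snd (h 1)"
      using side_h[of "2 * n + 1"] side_h[of 1] N
        side'[of "h (2 * n + 1)"] side'[of "h 1"] by auto
    ultimately show ?thesis by (simp add: prod_eq_iff)
  qed

  have ab: "\<phi> (alphad d x n k i) = \<phi> (betad d x n k i) \<or>
      den (\<phi> (alphad d x n k i)) B' = {} \<and> den (\<phi> (betad d x n k i)) B' = {}"
    if \<phi>: "endomorphism \<phi>" for \<phi>
  proof (rule disjCI)
    define g where "g y = \<phi> (gen_letter y)" for y
    note pairs = root_pairs_endomorphism[OF \<phi>, folded g_def]
    have restrict: "walk B 1 ?N z h" if "walk B 0 ?N z h" for z h and B :: "(nat \<times> bool, 'a) lgraph"
      using that by (auto simp: walk_def)
    assume "\<not> (den (\<phi> (alphad d x n k i)) B' = {} \<and> den (\<phi> (betad d x n k i)) B' = {})"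
    then have "root_pairs d (\<phi> (alphad d x n k i)) B' \<noteq> {} \<or> root_pairs d (\<phi> (betad d x n k i)) B' \<noteq> {}"
      by (cases d) (auto simp: root_pairs_def)
    then obtain h where h: "walk (subst_graph g B') 1 ?N (x \<circ> path_index n) h" "side B' (h 1) = d"
      using restrict unfolding pairs[OF B'] root_pairs_alpha_beta[OF x nm(1) kl(1) cover_subst_graph[OF B']] by auto
    note hB = walk_subst_graph[OF h B']
    show "\<phi> (alphad d x n k i) = \<phi> (betad d x n k i)"
    proof (rule free_psl_root_pairs_eqI[of d], intro equalityI subsetI)
      fix B :: "(nat \<times> bool, 'a) lgraph" and z assume B: "cover B"
      note ab_pairs = pairs[OF B] root_pairs_alpha_beta[OF x nm(1) kl(1) cover_subst_graph[OF B]]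
      {
        assume "z \<in> root_pairs d (\<phi> (betad d x n k i)) B"
        then show "z \<in> root_pairs d (\<phi> (alphad d x n k i)) B" using restrict unfolding ab_pairs by blast
      next
        assume "z \<in> root_pairs d (\<phi> (alphad d x n k i)) B"
        then obtain w where w: "z = (w 1, w 2)" "walk (subst_graph g B) 1 ?N (x \<circ> path_index n) w" "side B (w 1) = d"
          unfolding ab_pairs by auto
        have shift: "walk B 0 (2 * n) (y \<circ> Suc) (w \<circ> Suc)" if "walk B 1 ?N y w" for y w and B :: "(nat \<times> bool, 'a) lgraph"
          using that N by (auto simp: walk_def)
        have "(w \<circ> Suc) 0 = (w \<circ> Suc) (2 * n)"
        proof (rule closed_walk_transfer[OF B' B rk rk' _ shift[OF hB] shift[OF walk_subst_graph[OF w(2,3) B]]])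
          show "y = y'" if "mark B' v y" "mark B' v y'" for v y y'
            using mark'[of "fst v" "snd v"] that by auto
          show "(h \<circ> Suc) 0 = (h \<circ> Suc) (2 * n)" using closed[OF h] by simp
        qed
        then have w1: "w 1 = w (Suc (2 * n))" by simp
        define w' where "w' p = (if p = 0 then w (2 * n) else w p)" for p
        have "path_index n 0 = path_index n (2 * n)" using path_index_add[of n 0] by simp
        then have "walk (subst_graph g B) 0 ?N (x \<circ> path_index n) w'"
          unfolding walk_def using walkD[OF w(2)] walkD[OF w(2), of "2 * n"] w1 N nm by (auto simp: w'_def)
        then show "z \<in> root_pairs d (\<phi> (betad d x n k i)) B"
          unfolding ab_pairs using w by (auto simp: w'_def intro!: exI[of _ w'])
      }
    qed
  qed
  have "walk B' 1 ?M (x \<circ> path_index m) (\<lambda>p. (p, False))"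
    by (auto simp: walk_def B'_def thorned_def alpha_tree_def Let_def path_index_def)
  then have "((1, False), (2, False)) \<in> root_pairs d' (alphad d' x m l j) B'"
    unfolding root_pairs_alpha_beta[OF x nm(2) kl(2) B']
    by (intro CollectI exI[of _ "\<lambda>p. (p, False)"]) (simp add: side')
  then have "den (alphad d' x m l j) B' \<noteq> {}" by (auto simp: root_pairs_def split: if_splits)
  moreover have "endomorphism id" by (simp add: endomorphism_def)
  ultimately have "(alphad d' x m l j, betad d' x m l j) \<notin> image_null B'"
    using alpha_neq_beta[OF x nm(2) kl(2), of d' j] by (auto simp: image_null_def intro!: exI[of _ id])
  moreover have "(alphad d x n k i, betad d x n k i) \<in> image_null B'"
    using ab by (simp add: image_null_def)
  moreover assume "(alphad d' x m l j, betad d' x m l j) is_consequence_of (alphad d x n k i, betad d x n k i)"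
  ultimately show False
    using image_null_congruence[OF B']
    by (auto simp: is_consequence_of_def fully_invariant_congruence_generated_def)
qed

theorem corollary5p7:
  fixes x :: "nat \<Rightarrow> 'a :: countable"
    and n m i j k l :: nat
  assumes "inj_on x {1..}"
    and "n \<ge> 2" and "m \<ge> 2"
    and "i \<in> {1..2 * n}" and "j \<in> {1..2 * m}" and "odd j"
    and "k \<ge> 1" and "l \<ge> 1"
  shows
    "((alpha_star x m l j, beta_star x m l j) is_consequence_of
        (alpha_star x n k i, beta_star x n k i) \<longleftrightarrow>
      (n \<ge> m \<and> l > k) \<or>
      (n \<ge> m \<and> l = k \<and> int j \<ge> int i + 2 * int m - 2 * int n)) \<and>
     ((alpha_star x m l j, beta_star x m l j) is_consequence_of
        (alpha x n k i, beta x n k i) \<longleftrightarrow>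
      (n \<ge> m \<and> l > k) \<or>
      (n \<ge> m \<and> l = k \<and> int j > int i + 2 * int m - 2 * int n)) \<and>
     ((alpha x n k i, beta x n k i) is_consequence_of
        (alpha_star x m l j, beta_star x m l j) \<longleftrightarrow>
      (m \<ge> n \<and> k > l) \<or>
      (m \<ge> n \<and> k = l \<and> int i > int j + 2 * int n - 2 * int m))"
proof -
  have ij: "1 \<le> i" "i \<le> 2 * n" "1 \<le> j" "j \<le> 2 * m" using assms(4,5) by auto
  have star: "alpha_star x = alphad False x" "beta_star x = betad False x"
    and plain: "alpha x = alphad True x" "beta x = betad True x"
    by (simp_all add: alphad_def betad_def fun_eq_iff)
  have 1: "(alpha_star x m l j, beta_star x m l j) is_consequence_of (alpha_star x n k i, beta_star x n k i) \<longleftrightarrow>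
      m \<le> n \<and> (k < l \<or> l = k \<and> i + 2 * m \<le> j + 2 * n)" (is "?L \<longleftrightarrow> ?R")
  proof
    show "?L \<Longrightarrow> ?R" unfolding star
      using not_consequence[OF assms(1-3,7,8) ij, of False False] by fastforce
    show "?R \<Longrightarrow> ?L" unfolding star
      using ij assms by (intro consequence_same_side) auto
  qed
  have 2: "(alpha_star x m l j, beta_star x m l j) is_consequence_of (alpha x n k i, beta x n k i) \<longleftrightarrow>
      m \<le> n \<and> (k < l \<or> l = k \<and> i + 2 * m < j + 2 * n)" (is "?L \<longleftrightarrow> ?R")
  proof
    show "?L \<Longrightarrow> ?R" unfolding star plain
      using not_consequence[OF assms(1-3,7,8) ij, of False True] assms(6) by fastforce
    show "?R \<Longrightarrow> ?L" unfolding star plain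
      using ij assms consequence_opposite_side[OF assms(1,3), of n k l i j True] by auto
  qed
  have 3: "(alpha x n k i, beta x n k i) is_consequence_of (alpha_star x m l j, beta_star x m l j) \<longleftrightarrow>
      n \<le> m \<and> (l < k \<or> k = l \<and> j + 2 * n < i + 2 * m)" (is "?L \<longleftrightarrow> ?R")
  proof
    have "odd i" if "i + 2 * m = j + 2 * n"
      using arg_cong[OF that, of even] assms(6) by simp
    then show "?L \<Longrightarrow> ?R" unfolding star plain
      using not_consequence[OF assms(1,3,2,8,7) ij(3,4,1,2), of True False] by fastforce
    show "?R \<Longrightarrow> ?L" unfolding star plain
      using ij assms consequence_opposite_side[OF assms(1,2), of m l k j i False] by auto
  qed
  show ?thesis unfolding 1 2 3 by auto
qed

end
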